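(* Let $N \ge 1$ and consider the $N$-node linear feedforward network with its backward pass (as defined in the context), executed by DTR with the heuristic $h_{e^*}$ and a memory budget $B = \Omega(\sqrt{N})$. Then DTR executes one full forward pass and one full backward pass of this network using $\mathcal{O}(N)$ tensor operations (counting every computation and every rematerialization of a tensor as one operation).
   Context: Linear feedforward network: tensors $t_0, t_1, \dots, t_N$ and gradient tensors $\hat t_1, \dots, \hat t_N$. The input $t_0$ is always resident and does not count against the memory budget. For $1 \le i \le N$, $t_i = f_i(t_{i-1})$ ($f_1$ may be regarded as nullary). Gradients: $\hat t_N = \hat f_N(t_{N-1})$, $\hat t_i = \hat f_i(t_{i-1}, \hat t_{i+1})$ for $2 \le i \le N-1$, and $\hat t_1 = \hat f_1(\hat t_2)$. Every tensor occupies exactly one unit of memory and every operator application costs one unit (one tensor operation). The program computes, in order, $t_1, \dots, t_N$ (forward pass) and then $\hat t_N, \hat t_{N-1}, \dots, \hat t_1$ (backward pass). DTR (Dynamic Tensor Rematerialization) with memory budget $B$ executes the program's operations online, in order. To perform an operation, all its input tensors must be resident; an input that has been evicted is rematerialized by re-executing the operation that produced it, recursively rematerializing that operation's evicted inputs first. Inputs of an operation currently being (re)performed are locked and cannot be evicted. Whenever a tensor must be stored and the budget is full, DTR evicts (frees) a resident evictable tensor with the minimum heuristic score, repeating as needed. Liveness and banishing: a tensor is live while some pending operation of the program takes it as input; once it is no longer live and every tensor directly computed from it is resident or banished, it is banished (permanently freed, its memory reclaimed), and its children become unevictable from then on. Heuristic $h_{e^*}$: for a resident tensor $t$, its evicted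 neighborhood $e^*(t)$ is the set of currently evicted (already computed, not banished) tensors that would have to be rematerialized to recompute $t$ (evicted tensors reachable from $t$ backwards along dependency edges through evicted tensors only), together with the evicted tensors that need $t$ to be resident in order to be recomputed (evicted tensors reachable from $t$ forwards along dependency edges through evicted tensors only). Not-yet-computed tensors are never considered. $h_{e^*}(t) = |e^*(t)|$, and DTR evicts an evictable resident tensor minimizing it. *)

theory Defs
  imports Complex_Main
begin

(* Tensors of the N-node linear feedforward network:
   F i = t_i (forward, 1 <= i <= N),  G i = \hat t_i (gradient, 1 <= i <= N).
   The input t_0 is always resident, costs no memory, and is therefore not modelled
   as a tensor: operations reading only t_0 are treated as nullary. *)
datatype tensor = F nat | G nat

definition valid :: "nat \<Rightarrow> tensor \<Rightarrow> bool" where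
  "valid N x \<longleftrightarrow> (case x of F i \<Rightarrow> 1 \<le> i \<and> i \<le> N | G i \<Rightarrow> 1 \<le> i \<and> i \<le> N)"

(* inputs of the operation producing a tensor, in the order of the operator's arguments *)
fun parents :: "nat \<Rightarrow> tensor \<Rightarrow> tensor list" where
  "parents N (F i) = (if 2 \<le> i then [F (i - 1)] else [])"
| "parents N (G i) =
     (if i = N then (if 2 \<le> N then [F (N - 1)] else [])
      else if i = 1 then [G 2]
      else [F (i - 1), G (i + 1)])"

definition children :: "nat \<Rightarrow> tensor \<Rightarrow> tensor set" where
  "children N t = {x. valid N x \<and> t \<in> set (parents N x)}"

definition program :: "nat \<Rightarrow> tensor list" where
  "program N = map F [1..<N+1] @ map G (rev [1..<N+1])"

(* DTR runtime state: resident, evicted (computed, not banished), banished tensors,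
   number of tensor operations performed so far, number of program operations completed *)
record dtr_state =
  res :: "tensor set"
  evi :: "tensor set"
  ban :: "tensor set"
  nops :: nat
  ndone :: nat

definition init_state :: dtr_state where
  "init_state = \<lparr>res = {}, evi = {}, ban = {}, nops = 0, ndone = 0\<rparr>"

definition live :: "nat \<Rightarrow> dtr_state \<Rightarrow> tensor \<Rightarrow> bool" where
  "live N s t \<longleftrightarrow> (\<exists>x \<in> set (drop (ndone s) (program N)). t \<in> set (parents N x))"

definition banishable :: "nat \<Rightarrow> dtr_state \<Rightarrow> tensor \<Rightarrow> bool" where
  "banishable N s t \<longleftrightarrow> t \<in> res s \<union> evi s \<and> \<not> live N s t \<and>
      (\<forall>c \<in> children N t. c \<in> res s \<or> c \<in> ban s)"

(* banishing all banishable tensors (this is already a fixpoint) *)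
definition banish :: "nat \<Rightarrow> dtr_state \<Rightarrow> dtr_state" where
  "banish N s = (let X = {t. banishable N s t} in
     s\<lparr>res := res s - X, evi := evi s - X, ban := ban s \<union> X\<rparr>)"

inductive back_reach :: "nat \<Rightarrow> dtr_state \<Rightarrow> tensor \<Rightarrow> tensor \<Rightarrow> bool"
  for N s t where
  "u \<in> set (parents N t) \<Longrightarrow> u \<in> evi s \<Longrightarrow> back_reach N s t u"
| "back_reach N s t v \<Longrightarrow> u \<in> set (parents N v) \<Longrightarrow> u \<in> evi s \<Longrightarrow> back_reach N s t u"

inductive fwd_reach :: "nat \<Rightarrow> dtr_state \<Rightarrow> tensor \<Rightarrow> tensor \<Rightarrow> bool"
  for N s t where
  "t \<in> set (parents N u) \<Longrightarrow> u \<in> evi s \<Longrightarrow> fwd_reach N s t u"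
| "fwd_reach N s t v \<Longrightarrow> v \<in> set (parents N u) \<Longrightarrow> u \<in> evi s \<Longrightarrow> fwd_reach N s t u"

definition estar :: "nat \<Rightarrow> dtr_state \<Rightarrow> tensor \<Rightarrow> tensor set" where
  "estar N s t = {u. back_reach N s t u \<or> fwd_reach N s t u}"

definition h_estar :: "nat \<Rightarrow> dtr_state \<Rightarrow> tensor \<Rightarrow> nat" where
  "h_estar N s t = card (estar N s t)"

definition evictable :: "nat \<Rightarrow> dtr_state \<Rightarrow> tensor set \<Rightarrow> tensor \<Rightarrow> bool" where
  "evictable N s L t \<longleftrightarrow> t \<in> res s \<and> t \<notin> L \<and> (\<forall>p \<in> set (parents N t). p \<notin> ban s)"

definition evict :: "dtr_state \<Rightarrow> tensor \<Rightarrow> dtr_state" where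
  "evict s t = s\<lparr>res := res s - {t}, evi := insert t (evi s)\<rparr>"

definition store :: "dtr_state \<Rightarrow> tensor \<Rightarrow> dtr_state" where
  "store s x = s\<lparr>res := insert x (res s), evi := evi s - {x}, nops := Suc (nops s)\<rparr>"

(* making room for one tensor under budget B with lock set L; None = failure (nothing evictable).
   Ties in the heuristic are resolved nondeterministically. *)
inductive alloc :: "nat \<Rightarrow> nat \<Rightarrow> tensor set \<Rightarrow> dtr_state \<Rightarrow> dtr_state option \<Rightarrow> bool"
  for N B where
  alloc_free: "card (res s) < B \<Longrightarrow> alloc N B L s (Some s)"
| alloc_evict: "B \<le> card (res s) \<Longrightarrow> evictable N s L t \<Longrightarrow>
     (\<forall>t'. evictable N s L t' \<longrightarrow> h_estar N s t \<le> h_estar N s t') \<Longrightarrow>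
     alloc N B L (evict s t) r \<Longrightarrow> alloc N B L s r"
| alloc_fail: "B \<le> card (res s) \<Longrightarrow> \<not> (\<exists>t. evictable N s L t) \<Longrightarrow> alloc N B L s None"

inductive perform :: "nat \<Rightarrow> nat \<Rightarrow> tensor set \<Rightarrow> dtr_state \<Rightarrow> tensor \<Rightarrow> dtr_state option \<Rightarrow> bool"
  and ensure :: "nat \<Rightarrow> nat \<Rightarrow> tensor set \<Rightarrow> dtr_state \<Rightarrow> tensor list \<Rightarrow> dtr_state option \<Rightarrow> bool"
  for N B where
  perform_ok: "ensure N B L s (parents N x) (Some s1) \<Longrightarrow>
     alloc N B (L \<union> set (parents N x)) s1 (Some s2) \<Longrightarrow>
     perform N B L s x (Some (banish N (store s2 x)))"
| perform_fail_inputs: "ensure N B L s (parents N x) None \<Longrightarrow> perform N B L s x None"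
| perform_fail_alloc: "ensure N B L s (parents N x) (Some s1) \<Longrightarrow>
     alloc N B (L \<union> set (parents N x)) s1 None \<Longrightarrow> perform N B L s x None"
| ensure_nil: "ensure N B L s [] (Some s)"
| ensure_res: "p \<in> res s \<Longrightarrow> ensure N B (insert p L) s ps r \<Longrightarrow> ensure N B L s (p # ps) r"
| ensure_remat: "p \<in> evi s \<Longrightarrow> perform N B L s p (Some s') \<Longrightarrow>
     ensure N B (insert p L) s' ps r \<Longrightarrow> ensure N B L s (p # ps) r"
| ensure_remat_fail: "p \<in> evi s \<Longrightarrow> perform N B L s p None \<Longrightarrow> ensure N B L s (p # ps) None"
| ensure_missing: "p \<notin> res s \<Longrightarrow> p \<notin> evi s \<Longrightarrow> ensure N B L s (p # ps) None"

inductive run :: "nat \<Rightarrow> nat \<Rightarrow> tensor list \<Rightarrow> dtr_state \<Rightarrow> dtr_state option \<Rightarrow> bool"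
  for N B where
  run_nil: "run N B [] s (Some s)"
| run_step: "perform N B {} s x (Some s') \<Longrightarrow>
     run N B xs (banish N (s'\<lparr>ndone := Suc (ndone s')\<rparr>)) r \<Longrightarrow> run N B (x # xs) s r"
| run_fail: "perform N B {} s x None \<Longrightarrow> run N B (x # xs) s None"

definition dtr_run :: "nat \<Rightarrow> nat \<Rightarrow> dtr_state option \<Rightarrow> bool" where
  "dtr_run N B r \<longleftrightarrow> run N B (program N) init_state r"

end

theory Submission
  imports Defs
begin

text \<open>Only forward tensors are ever evicted, so a state is described by the lengths of the maximal
evicted runs (gaps) between resident forward tensors. The score of a resident is the sum of its two
neighbouring gaps, and evicting it merges them. Averaging bounds the minimal score: every gap has
length \<open>O(N / B)\<close>, and while a trailing gap of length \<open>L\<close> is being recomputed with \<open>v\<close> memory slots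
not occupied by residents below it, every new gap has length at most \<open>2L / (v - 2) + 1\<close>.

A backward step costs the length of the trailing gap. It is paid for by a potential that charges
a gap of length at most \<open>L\<close> with \<open>v\<close> slots above the residents below it the amount
\<open>L + 10 L sqrt (L / v) + 10000 L^2 / v^(3/2)\<close>. Splitting the gap into \<open>v\<close> gaps of length \<open>O(L / v)\<close>
lowers the potential by at least \<open>L\<close>, and initially the potential is
\<open>O(N)\<close> because there are at most \<open>B\<close> gaps of length \<open>O(N / B) = O(sqrt N)\<close>.
Gaps are charged for an upper envelope \<open>H\<close> of their lengths that increases towards the input; then
evictions below the trailing gap, which create gaps no longer than the trailing one, are free.\<close>

section \<open>Gap lists\<close>

text \<open>Gaps are listed from the output side down to the input. Each entry \<open>x\<close> stands for \<open>x\<close> evicted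
tensors together with the resident tensor directly after them, so \<open>extent t\<close> is the index of the last
resident. Evicted tensors after that resident form the trailing gap, which is kept separately. The
number of entries following an entry is the number of residents below its gap.\<close>

fun extent :: "nat list \<Rightarrow> nat" where
  "extent [] = 0"
| "extent (x # xs) = Suc x + extent xs"

fun residents :: "nat list \<Rightarrow> nat set" where
  "residents [] = {}"
| "residents (x # xs) = insert (extent (x # xs)) (residents xs)"

text \<open>The envelope is indexed by the number of residents below a gap, an index that is not
  affected by pushing new entries on top.\<close>

fun bounded_by :: "(nat \<Rightarrow> nat) \<Rightarrow> nat list \<Rightarrow> bool" where
  "bounded_by H [] \<longleftrightarrow> True"
| "bounded_by H (x # xs) \<longleftrightarrow> x \<le> H (length xs) \<and> bounded_by H xs"

fun extent_above :: "nat \<Rightarrow> nat list \<Rightarrow> nat" where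
  "extent_above P [] = 0"
| "extent_above P (x # xs) = (if P \<le> length xs then Suc x else 0) + extent_above P xs"

text \<open>Effect of one eviction of minimal score: the resident ending the entry \<open>x\<close>
  disappears and joins its two neighbouring gaps. The resident of the first entry can never
  disappear; it is the locked input of the next operation.\<close>

definition min_merge :: "nat list \<Rightarrow> nat list \<Rightarrow> bool" where
  "min_merge t t' \<longleftrightarrow> (\<exists>ys y x zs. t = ys @ y # x # zs \<and> t' = ys @ Suc (y + x) # zs \<and>
     (\<forall>ys' y' x' zs'. t = ys' @ y' # x' # zs' \<longrightarrow> y + x \<le> y' + x'))"

section \<open>Residents, merges and envelopes of gap lists\<close>

lemma extent_append [simp]: "extent (xs @ ys) = extent xs + extent ys"
  by (induction xs) auto

lemma extent_eq: "extent xs = sum_list xs + length xs"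
  by (induction xs) auto

lemma residents_iff:
  "i \<in> residents t \<longleftrightarrow> (\<exists>ys x zs. t = ys @ x # zs \<and> i = extent (x # zs))"
  by (induction t) (auto simp: Cons_eq_append_conv)

lemma residents_bounds: "i \<in> residents t \<Longrightarrow> 1 \<le> i \<and> i \<le> extent t"
  by (auto simp: residents_iff)

lemma finite_residents [simp]: "finite (residents t)"
  by (induction t) auto

lemma extent_in_residents [simp]: "t \<noteq> [] \<Longrightarrow> extent t \<in> residents t"
  by (cases t) auto

lemma card_residents [simp]: "card (residents t) = length t"
proof (induction t)
  case (Cons x t)
  have "extent (x # t) \<notin> residents t" using residents_bounds by fastforce
  then show ?case using Cons by simp
qed simp

lemma residents_merge:
  "residents (ys @ Suc (y + x) # zs) = residents (ys @ y # x # zs) - {extent (x # zs)}"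
proof (induction ys)
  case Nil
  have "extent (x # zs) \<notin> residents zs" using residents_bounds by fastforce
  then show ?case by auto
next
  case (Cons a ys)
  have "extent (a # ys @ y # x # zs) \<noteq> extent (x # zs)" by simp
  then have "insert (extent (a # ys @ y # x # zs)) (residents (ys @ y # x # zs) - {extent (x # zs)})
    = residents ((a # ys) @ y # x # zs) - {extent (x # zs)}"
    by (simp only: append_Cons residents.simps insert_Diff_if) simp
  moreover have "residents ((a # ys) @ Suc (y + x) # zs)
    = insert (extent (a # ys @ y # x # zs)) (residents (ys @ Suc (y + x) # zs))"
    by (simp add: ac_simps)
  ultimately show ?case using Cons by (simp only:)
qed

lemma residents_between_gaps:
  "residents (ys @ y # x # zs) \<inter> {extent zs<..<extent (y # x # zs)} = {extent (x # zs)}"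
proof (induction ys)
  case Nil
  have "residents zs \<inter> {extent zs<..<extent (y # x # zs)} = {}" using residents_bounds by fastforce
  then show ?case by auto
next
  case (Cons a ys)
  have "extent (a # ys @ y # x # zs) \<notin> {extent zs<..<extent (y # x # zs)}" by simp
  then have "residents ((a # ys) @ y # x # zs) \<inter> {extent zs<..<extent (y # x # zs)}
     = residents (ys @ y # x # zs) \<inter> {extent zs<..<extent (y # x # zs)}"
    by (simp only: append_Cons residents.simps Int_insert_left_if0 not_False_eq_True)
  then show ?case using Cons by (simp only:)
qed

lemma bounded_by_append:
  "bounded_by H (xs @ ys) \<longleftrightarrow> bounded_by (\<lambda>i. H (i + length ys)) xs \<and> bounded_by H ys"
  by (induction xs) auto

lemma bounded_by_mono: "bounded_by H xs \<Longrightarrow> (\<And>i. i < length xs \<Longrightarrow> H i \<le> H' i) \<Longrightarrow> bounded_by H' xs"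
  by (induction xs) (auto intro: order_trans)

text \<open>A merge lowers the index of every entry above it by one, where an antitone envelope is
  no smaller; only the merged entry needs a bound of its own.\<close>

lemma bounded_by_merge:
  assumes "antimono H" "bounded_by H (ys @ y # x # zs)" "Suc (y + x) \<le> H (length zs)"
  shows "bounded_by H (ys @ Suc (y + x) # zs)"
proof -
  have "bounded_by (\<lambda>i. H (i + length (y # x # zs))) ys" "bounded_by H zs"
    using assms(2) by (simp_all add: bounded_by_append)
  moreover from this(1) have "bounded_by (\<lambda>i. H (i + length (Suc (y + x) # zs))) ys"
    by (rule bounded_by_mono) (simp add: antimonoD[OF assms(1)])
  ultimately show ?thesis using assms(3) by (simp add: bounded_by_append)
qed

lemma extent_above_merge:
  "extent_above P (ys @ Suc (y + x) # zs) \<le> extent_above P (ys @ y # x # zs)"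
  by (induction ys) auto

lemma extent_above_le:
  assumes "bounded_by H xs" "antimono H"
  shows "extent_above P xs \<le> (length xs - P) * Suc (H P)"
  using assms(1)
proof (induction xs)
  case (Cons x xs)
  show ?case
  proof (cases "P \<le> length xs")
    case True
    then have "x \<le> H P" using Cons.prems antimonoD[OF assms(2) True] by simp
    then show ?thesis using Cons True by (simp add: Suc_diff_le)
  next
    case False
    then show ?thesis using Cons by simp
  qed
qed simp

section \<open>Averaging over adjacent gaps\<close>

text \<open>Double counting: the sum over all adjacent pairs uses each entry at most twice.\<close>

lemma adjacent_sums_average:
  assumes "\<And>ys y x zs. ns = ys @ y # x # zs \<Longrightarrow> m \<le> y + x"
  shows "m * (length ns - 1) \<le> 2 * sum_list ns"
proof -
  \<comment> \<open>The first entry occurs in one pair only; recording this slack makes the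
    induction work.\<close>
  have "m * (length ns - 1) + hd ns \<le> 2 * sum_list ns" if "ns \<noteq> []"
    using that assms
  proof (induction ns rule: induct_list012)
    case (3 a b ns)
    have "m \<le> a + b" using "3.prems"(2)[of "[]" a b ns] by simp
    moreover have "m * (length (b # ns) - 1) + hd (b # ns) \<le> 2 * sum_list (b # ns)"
    proof (rule "3.IH"(2))
      show "m \<le> y + x" if "b # ns = ys @ y # x # zs" for ys y x zs
        using "3.prems"(2)[of "a # ys" y x zs] that by simp
    qed simp
    ultimately show ?case by simp
  qed auto
  then show ?thesis by (cases ns) auto
qed

text \<open>A minimum over the whole list is at most the average over any prefix \<open>ns\<close>,
  even when the merged pair lies outside \<open>ns\<close>.\<close>

lemma min_merge_le_average:
  assumes "min_merge (ns @ os) t'"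
  obtains ys y x zs where "ns @ os = ys @ y # x # zs" "t' = ys @ Suc (y + x) # zs"
    "(y + x) * (length ns - 1) \<le> 2 * sum_list ns"
    "2 \<le> length ns \<longrightarrow> y + x + 2 \<le> extent ns"
proof -
  obtain ys y x zs where t: "ns @ os = ys @ y # x # zs" "t' = ys @ Suc (y + x) # zs"
    and m: "\<And>ys' y' x' zs'. ns @ os = ys' @ y' # x' # zs' \<Longrightarrow> y + x \<le> y' + x'"
    using assms unfolding min_merge_def by blast
  have m': "y + x \<le> y' + x'" if "ns = ys' @ y' # x' # zs'" for ys' y' x' zs'
    using m[of ys' y' x' "zs' @ os"] that by simp
  have "y + x + 2 \<le> extent ns" if "2 \<le> length ns"
  proof -
    obtain a b r where "ns = a # b # r" using \<open>2 \<le> length ns\<close>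
      by (metis Suc_le_length_iff numeral_2_eq_2)
    then show ?thesis using m'[of "[]" a b r] by simp
  qed
  moreover have "(y + x) * (length ns - 1) \<le> 2 * sum_list ns"
    using adjacent_sums_average m' by blast
  ultimately show thesis using that t by blast
qed

lemma min_merge_extent: "min_merge t t' \<Longrightarrow> extent t' = extent t"
  by (auto simp: min_merge_def)

text \<open>Invariant while a trailing gap of initial length \<open>L\<close> above \<open>p\<close> residents is recomputed, \<open>g\<close>
tensors of it being still missing: at most \<open>p\<close> entries (\<open>os\<close>) reach below the gap, even if the
resident bounding it has been evicted meanwhile.\<close>

definition refill :: "nat \<Rightarrow> nat \<Rightarrow> nat \<Rightarrow> nat list \<Rightarrow> bool" where
  "refill L p g t \<longleftrightarrow> (\<exists>ns os. t = ns @ os \<and> length os \<le> p \<and> extent ns + g \<le> L)"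

lemma refill_start: "refill g (length t) g t"
  unfolding refill_def by force

lemma refill_push: "refill L p (Suc g) t \<Longrightarrow> refill L p g (0 # t)"
proof -
  assume "refill L p (Suc g) t"
  then obtain ns os where "t = ns @ os" "length os \<le> p" "extent ns + Suc g \<le> L"
    unfolding refill_def by blast
  then show ?thesis unfolding refill_def by (intro exI[of _ "0 # ns"] exI[of _ os]) auto
qed

lemma refill_merge:
  assumes "refill L p g (ys @ y # x # zs)"
  shows "refill L p g (ys @ Suc (y + x) # zs)"
proof -
  obtain ns os where *: "ys @ y # x # zs = ns @ os" "length os \<le> p" "extent ns + g \<le> L"
    using assms unfolding refill_def by blast
  from *(1) consider us where "ys = ns @ us" "os = us @ y # x # zs"
    | "ns = ys @ [y]" "os = x # zs"
    | us where "ns = ys @ y # x # us" "zs = us @ os"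
    by (auto simp: append_eq_append_conv2 Cons_eq_append_conv)
  then show ?thesis
  proof cases
    case 1
    then show ?thesis unfolding refill_def using *
      by (intro exI[of _ ns] exI[of _ "us @ Suc (y + x) # zs"]) auto
  next
    \<comment> \<open>Here the resident bounding the gap from below is evicted: the merged entry is
      assigned to \<open>os\<close>, whose length stays the same.\<close>
    case 2
    then show ?thesis unfolding refill_def using *
      by (intro exI[of _ ys] exI[of _ "Suc (y + x) # zs"]) auto
  next
    case 3
    then show ?thesis unfolding refill_def using *
      by (intro exI[of _ "ys @ Suc (y + x) # us"] exI[of _ os]) auto
  qed
qed

lemma length_le_extent: "length t \<le> extent t"
  by (simp add: extent_eq)

text \<open>Of at least \<open>B - 1\<close> entries (one slot may hold a gradient) at most
  \<open>p\<close> reach below the gap, so at least \<open>B - p - 1\<close> entries share the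
  extent \<open>L\<close>. The bound \<open>B \<le> L + p + 1\<close> says that nothing is evicted
  while all recomputed tensors fit.\<close>

lemma min_merge_refill:
  assumes "refill L p g t" "min_merge t t'" "B - 1 \<le> length t" "p + 3 \<le> B"
  obtains ys y x zs where "t = ys @ y # x # zs" "t' = ys @ Suc (y + x) # zs"
    "y + x \<le> 2 * L div (B - p - 2)" "Suc (y + x) \<le> L" "B \<le> L + p + 1"
proof -
  obtain ns os where *: "t = ns @ os" "length os \<le> p" "extent ns + g \<le> L"
    using assms(1) unfolding refill_def by blast
  obtain ys y x zs where t: "t = ys @ y # x # zs" "t' = ys @ Suc (y + x) # zs"
    "(y + x) * (length ns - 1) \<le> 2 * sum_list ns"
    "2 \<le> length ns \<longrightarrow> y + x + 2 \<le> extent ns"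
    using min_merge_le_average assms(2) *(1) by metis
  have q: "B - p - 1 \<le> length ns" using * assms by auto
  have "(y + x) * (B - p - 2) \<le> (y + x) * (length ns - 1)"
    using q by (intro mult_left_mono) auto
  also have "\<dots> \<le> 2 * L" using t(3) * by (simp add: extent_eq)
  finally have "y + x \<le> 2 * L div (B - p - 2)" using assms(4) by (simp add: less_eq_div_iff_mult_less_eq)
  moreover have "Suc (y + x) \<le> L" using q t(4) * assms(4) by linarith
  moreover have "B \<le> L + p + 1" using q length_le_extent[of ns] * by linarith
  ultimately show thesis using that t by blast
qed

section \<open>The amortisation inequality\<close>

text \<open>The linear term pays when everything fits into the \<open>v\<close> slots, the second one for
\<open>v \<le> L\<close>, and the third one dominates the gaps created with few slots of their own, where
\<open>L^2\<close> operations may be needed.\<close>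

definition charge :: "nat \<Rightarrow> nat \<Rightarrow> real" where
  "charge L v = L + 10 * L * sqrt (L / v) + 10000 * (real L)\<^sup>2 / (v * sqrt v)"

lemma charge_nonneg [simp]: "0 \<le> charge L v"
  by (simp add: charge_def)

lemma charge_ge: "real L \<le> charge L v"
  by (simp add: charge_def)

lemma charge_0 [simp]: "charge 0 v = 0"
  by (simp add: charge_def)

lemma charge_mono: "L \<le> L' \<Longrightarrow> charge L v \<le> charge L' v"
  unfolding charge_def
  by (intro add_mono mult_mono divide_right_mono real_sqrt_le_mono power_mono) auto

section \<open>Telescoping bounds for sums over memory slots\<close>

lemma inverse_sqrt_le_diff:
  assumes "1 \<le> r"
  shows "1 / sqrt r \<le> 2 * (sqrt r - sqrt (r - 1))"
proof -
  \<comment> \<open>The difference of the roots is the reciprocal of their sum.\<close>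
  have "(sqrt r - sqrt (r - 1)) * (sqrt r + sqrt (r - 1)) = 1"
    using assms by (simp add: algebra_simps)
  moreover have "sqrt r + sqrt (r - 1) \<le> 2 * sqrt r" using assms by simp
  moreover have "0 \<le> sqrt r - sqrt (r - 1)" using assms by simp
  ultimately have "1 \<le> (sqrt r - sqrt (r - 1)) * (2 * sqrt r)"
    by (metis mult_left_mono)
  then show ?thesis using assms by (simp add: field_simps)
qed

lemma sum_inverse_sqrt_le:
  assumes "p \<le> q" "q \<le> B"
  shows "(\<Sum>i=p..<q. 1 / sqrt (real (B - i))) \<le> 2 * (sqrt (real (B - p)) - sqrt (real (B - q)))"
  using assms
proof (induction q rule: dec_induct)
  case (step q)
  have r: "real (B - Suc q) = real (B - q) - 1" using step by linarith
  have "(\<Sum>i=p..<Suc q. 1 / sqrt (real (B - i)))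
      = (\<Sum>i=p..<q. 1 / sqrt (real (B - i))) + 1 / sqrt (real (B - q))"
    using step by simp
  also have "\<dots> \<le> 2 * (sqrt (real (B - p)) - sqrt (real (B - q)))
      + 2 * (sqrt (real (B - q)) - sqrt (real (B - q) - 1))"
    using step by (intro add_mono inverse_sqrt_le_diff) linarith+
  finally show ?case unfolding r by (simp add: algebra_simps)
qed simp

lemma inverse_pow_le_diff:
  assumes "2 \<le> r"
  shows "1 / (r * sqrt r) \<le> 4 * (1 / sqrt (r - 1) - 1 / sqrt r)"
proof -
  have pos: "0 < sqrt r" "0 < sqrt (r - 1)" using assms by auto
  have "1 / (r * sqrt r) = 1 / sqrt r * (1 / r)" by simp
  also have "\<dots> \<le> 2 * (sqrt r - sqrt (r - 1)) * (1 / (sqrt r * sqrt (r - 1)))"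
  proof (rule mult_mono)
    have "sqrt r * sqrt (r - 1) \<le> sqrt r * sqrt r" using assms by (intro mult_left_mono) auto
    then show "1 / r \<le> 1 / (sqrt r * sqrt (r - 1))"
      using assms pos by (intro divide_left_mono) auto
  qed (use assms inverse_sqrt_le_diff[of r] in auto)
  also have "\<dots> = 2 * (1 / sqrt (r - 1) - 1 / sqrt r)" using pos by (simp add: field_simps)
  also have "\<dots> \<le> 4 * (1 / sqrt (r - 1) - 1 / sqrt r)"
  proof -
    have "1 / sqrt r \<le> 1 / sqrt (r - 1)" using assms by (intro divide_left_mono) auto
    then show ?thesis by argo
  qed
  finally show ?thesis .
qed

lemma sum_inverse_pow_le:
  assumes "p \<le> q" "q < B"
  shows "(\<Sum>i=p..<q. 1 / (real (B - i) * sqrt (real (B - i))))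
    \<le> 4 * (1 / sqrt (real (B - q)) - 1 / sqrt (real (B - p)))"
  using assms
proof (induction q rule: dec_induct)
  case (step q)
  have r: "real (B - Suc q) = real (B - q) - 1" using step by linarith
  have "(\<Sum>i=p..<Suc q. 1 / (real (B - i) * sqrt (real (B - i))))
      = (\<Sum>i=p..<q. 1 / (real (B - i) * sqrt (real (B - i)))) + 1 / (real (B - q) * sqrt (real (B - q)))"
    using step by simp
  also have "\<dots> \<le> 4 * (1 / sqrt (real (B - q)) - 1 / sqrt (real (B - p)))
      + 4 * (1 / sqrt (real (B - q) - 1) - 1 / sqrt (real (B - q)))"
    using step by (intro add_mono inverse_pow_le_diff) linarith+
  finally show ?case unfolding r by (simp add: algebra_simps)
qed simp

text \<open>The second term of the charge sums to a difference of roots, whereas the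
  \<open>v^(-3/2)\<close> terms have a bounded sum; so the quadratic part costs a constant multiple
  of \<open>L^2\<close>, however many gaps there are.\<close>

lemma sum_charge_le:
  assumes "p \<le> q" "q < B"
  shows "(\<Sum>i=p..<q. charge L (B - i))
    \<le> (real q - real p) * L + 20 * (L * sqrt L) * (sqrt (real (B - p)) - sqrt (real (B - q)))
      + 40000 * (real L)\<^sup>2"
proof -
  have "(\<Sum>i=p..<q. charge L (B - i)) = (\<Sum>i=p..<q. real L)
      + 10 * (L * sqrt L) * (\<Sum>i=p..<q. 1 / sqrt (real (B - i)))
      + 10000 * (real L)\<^sup>2 * (\<Sum>i=p..<q. 1 / (real (B - i) * sqrt (real (B - i))))"
    unfolding charge_def sum.distrib sum_distrib_left
    by (intro arg_cong2[of _ _ _ _ "(+)"] sum.cong) (auto simp: real_sqrt_divide)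
  also have "\<dots> \<le> (real q - real p) * L
      + 10 * (L * sqrt L) * (2 * (sqrt (real (B - p)) - sqrt (real (B - q))))
      + 10000 * (real L)\<^sup>2 * 4"
  proof (intro add_mono mult_left_mono)
    have "4 * (1 / sqrt (real (B - q)) - 1 / sqrt (real (B - p))) \<le> 4 * (1 - 0)"
      using assms by (intro mult_left_mono diff_mono) auto
    then show "(\<Sum>i=p..<q. 1 / (real (B - i) * sqrt (real (B - i)))) \<le> 4"
      using order_trans[OF sum_inverse_pow_le[OF assms]] by simp
  qed (use assms sum_inverse_sqrt_le[of p q B] in auto)
  finally show ?thesis by (simp add: algebra_simps)
qed

text \<open>This is the case in which evictions occur. The left side adds the cost \<open>L\<close>
  of the refill, the bound of \<open>sum_charge_le\<close> for the new gaps of length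
  \<open>l\<close>, and the second part of the potential for the last 40000 slots.\<close>

lemma charge_pays_for_refill:
  assumes v: "40000 \<le> v" "v \<le> L + 1" and l: "real l \<le> 2 * L / (real v - 2) + 1"
  shows "real L + real v * l + 20 * (l * sqrt l) * sqrt v + 40000 * (real l)\<^sup>2
    + 40000 * (real l + 1) * l \<le> charge L v"
proof -
  define u where "u = real L / v"
  define w where "w = sqrt v"
  define z where "z = sqrt u"
  have w: "200 \<le> w" "w * w = v" using v real_sqrt_le_mono[of 40000 "real v"]
    by (auto simp: w_def)
  have L: "real L = u * v" using v by (simp add: u_def)
  have u: "99 / 100 \<le> u" using v by (simp add: u_def field_simps)
  have z: "99 / 100 \<le> z" "z * z = u" "0 \<le> z"
  proof -
    have "(99 / 100)\<^sup>2 \<le> u" using u by (simp add: power2_eq_square)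
    then show "99 / 100 \<le> z" unfolding z_def by (rule real_le_rsqrt)
  qed (use u in \<open>auto simp: z_def\<close>)
  have "2 * L / (real v - 2) \<le> (5 / 2) * u"
    using v by (simp add: u_def field_simps)
  \<comment> \<open>Since \<open>u \<ge> 99 / 100\<close>, the rounding term 1 is at most a multiple
    of \<open>u\<close>.\<close>
  then have l4: "l \<le> 4 * u" using l u by linarith
  have sl: "sqrt l \<le> 2 * z"
    using real_sqrt_le_mono[OF l4] by (simp add: real_sqrt_mult z_def)
  have "l * sqrt l \<le> (4 * u) * (2 * z)" using l4 sl u z by (intro mult_mono) auto
  then have t1: "20 * (l * sqrt l) * w \<le> 160 * (u * z * w)"
    using w by (simp add: mult_right_mono)
  have l2: "(real l)\<^sup>2 \<le> 16 * (u * u)"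
    using power_mono[OF l4, of 2] by (simp add: power2_eq_square)
  have uu: "u \<le> 102 / 100 * (u * u)" using u by (simp add: field_simps)
  have t2: "real v * l \<le> 4 * (u * v)" using mult_left_mono[OF l4, of v] by (simp add: ac_simps)
  have t3: "40000 * (real l + 1) * real l = 40000 * (real l)\<^sup>2 + 40000 * l"
    by (simp add: power2_eq_square algebra_simps)
  \<comment> \<open>The threshold 40000 enters as \<open>w \<ge> 200\<close>. Together
    \<open>b1\<close> and \<open>b2\<close> use less than the \<open>10 * (u * z * v)\<close>
    available in the charge.\<close>
  have b1: "160 * (u * z * w) \<le> 8 / 10 * (u * z * v)"
  proof -
    have "(u * z * w) * 200 \<le> (u * z * w) * w" using w u z by (intro mult_left_mono) auto
    also have "\<dots> = u * z * v" using w by (simp add: mult.assoc)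
    finally show ?thesis by linarith
  qed
  have b2: "4 * (u * v) \<le> 5 * (u * z * v)"
  proof -
    have "(u * v) * (99 / 100) \<le> (u * v) * z" using u z by (intro mult_left_mono) auto
    moreover have "0 \<le> u * v" using u by simp
    ultimately show ?thesis by (simp add: mult.commute mult.left_commute)
  qed
  \<comment> \<open>The quadratic terms are at most \<open>80000 * 16 * (u * u)\<close> and the
    remaining \<open>40000 * l\<close> at most \<open>160000 * u\<close>; 2000000 covers
    both.\<close>
  have b3: "2000000 * (u * u) \<le> 10000 * (u * u * w)"
    using mult_left_mono[OF w(1), of "u * u"] u by simp
  have b4: "0 \<le> u * z * v" using u z by simp
  have "charge L v = L + 10 * (u * z * v) + 10000 * (u * u * w)"
  proof -
    have "sqrt (L / v) = z" by (simp add: z_def u_def)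
    moreover have "(real L)\<^sup>2 / (v * sqrt v) = u * u * w"
    proof -
      have "(real L)\<^sup>2 / (v * sqrt v) = u * u * (w * w * (w * w)) / (w * w * w)"
        unfolding L using w by (simp add: power2_eq_square w_def)
      also have "\<dots> = u * u * w" using w(1) by (simp add: field_simps)
      finally show ?thesis .
    qed
    moreover have "10000 * (real L)\<^sup>2 / (v * sqrt v) = 10000 * ((real L)\<^sup>2 / (v * sqrt v))"
      by simp
    moreover have "10 * real L * z = 10 * (u * z * v)" using L by simp
    ultimately show ?thesis unfolding charge_def by (simp only:)
  qed
  then show ?thesis unfolding w_def[symmetric]
    using t1 l2 uu t2 t3 b1 b2 b3 b4 l4 by linarith
qed

text \<open>With fewer than 40000 slots averaging gives no useful gain. There each remaining tensor is
charged the maximal gap length instead.\<close>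

definition potential :: "nat \<Rightarrow> (nat \<Rightarrow> nat) \<Rightarrow> nat list \<Rightarrow> real" where
  "potential B H gs = (\<Sum>i<min (length gs) (B - 40000). charge (H i) (B - i))
     + real (extent_above (B - 40000) gs) * H (B - 40000)"

text \<open>Bound for the gaps created by a refill. If everything fits, nothing is evicted and all
  new gaps are empty; with more than 40000 slots averaging applies, and \<open>+ 1\<close> is the
  evicted resident itself; otherwise only the trivial bound \<open>L\<close> is kept.\<close>

definition refill_bound :: "nat \<Rightarrow> nat \<Rightarrow> nat \<Rightarrow> nat" where
  "refill_bound B p L = (if L + p + 1 < B then 0
     else if p < B - 40000 then 2 * L div (B - p - 2) + 1 else L)"

lemma refill_bound_le: 
  assumes "p + 3 \<le> B" shows "refill_bound B p L \<le> L"
proof -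
  have "2 * L div (B - p - 2) + 1 \<le> L" if "p < B - 40000" "\<not> L + p + 1 < B"
  proof -
    have "2 * L div (B - p - 2) \<le> 2 * L div 4" using that by (intro div_le_mono2) auto
    then show ?thesis using that by linarith
  qed
  then show ?thesis by (auto simp: refill_bound_def)
qed

text \<open>With many slots the charge of the trailing gap is traded for its recomputation and for
  the charges of the new gaps. With few slots the loss of one tensor in \<open>extent_above\<close>
  releases \<open>H (B - 40000)\<close>, which is at least \<open>g\<close>.\<close>

lemma potential_step:
  assumes H: "antimono H" and p: "length t + 3 \<le> B" "40000 < B" and g: "g \<le> H (length t)"
    and H': "H' = (\<lambda>i. if i < length t then H i else refill_bound B (length t) g)"
    and gs': "bounded_by H' gs'" "length gs' + 2 \<le> B" "antimono H'"
    and dec: "B - 40000 \<le> length t \<Longrightarrow>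
       Suc (extent_above (B - 40000) gs') \<le> extent_above (B - 40000) (g # t)"
  shows "g + potential B H' gs' \<le> potential B H (g # t)"
proof (cases "B - 40000 \<le> length t")
  case True
  let ?P = "B - 40000"
  have le: "H' i \<le> H i" if "i \<le> length t" for i
    using that refill_bound_le[OF p(1), of g] g H' by auto
  have "g \<le> H ?P" using g antimonoD[OF H True] by linarith
  have "(\<Sum>i<min (length gs') ?P. charge (H' i) (B - i)) \<le> (\<Sum>i<min (length gs') ?P. charge (H i) (B - i))"
    using True by (intro sum_mono charge_mono le) auto
  also have "\<dots> \<le> (\<Sum>i<min (length (g # t)) ?P. charge (H i) (B - i))"
    using True by (intro sum_mono2) auto
  finally have a: "(\<Sum>i<min (length gs') ?P. charge (H' i) (B - i))
      \<le> (\<Sum>i<min (length (g # t)) ?P. charge (H i) (B - i))" .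
  have "g + real (extent_above ?P gs') * H' ?P \<le> H ?P + real (extent_above ?P gs') * H ?P"
    using \<open>g \<le> H ?P\<close> le[OF True] by (intro add_mono mult_left_mono) auto
  also have "\<dots> = real (Suc (extent_above ?P gs')) * H ?P" by (simp add: algebra_simps)
  also have "\<dots> \<le> real (extent_above ?P (g # t)) * H ?P"
    using dec[OF True] by (intro mult_right_mono) (auto simp del: extent_above.simps)
  finally show ?thesis unfolding potential_def using a by linarith
next
  case False
  let ?P = "B - 40000" and ?p = "length t" and ?l = "refill_bound B (length t) g"
  have "(\<Sum>i<min (length gs') ?P. charge (H' i) (B - i)) \<le> (\<Sum>i<?P. charge (H' i) (B - i))"
    by (intro sum_mono2) auto
  also have "\<dots> = (\<Sum>i<?p. charge (H' i) (B - i)) + (\<Sum>i=?p..<?P. charge (H' i) (B - i))"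
    using False sum.atLeastLessThan_concat[of 0 ?p ?P "\<lambda>i. charge (H' i) (B - i)"]
    by (simp add: lessThan_atLeast0)
  also have "\<dots> = (\<Sum>i<?p. charge (H i) (B - i)) + (\<Sum>i=?p..<?P. charge ?l (B - i))"
    using H' by simp
  finally have a: "(\<Sum>i<min (length gs') ?P. charge (H' i) (B - i))
     \<le> (\<Sum>i<?p. charge (H i) (B - i)) + (\<Sum>i=?p..<?P. charge ?l (B - i))" .
  have HP: "H' ?P = ?l" using False H' by simp
  have "extent_above ?P gs' \<le> (length gs' - ?P) * Suc ?l"
    using extent_above_le[OF gs'(1,3), of ?P] HP by simp
  \<comment> \<open>At most 40000 entries lie at or above index \<open>?P\<close>, because
    \<open>length gs' + 2 \<le> B\<close>.\<close>
  also have "\<dots> \<le> 40000 * Suc ?l" using gs'(2) by (intro mult_right_mono) auto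
  finally have "real (extent_above ?P gs') \<le> real (40000 * Suc ?l)" by linarith
  then have b: "real (extent_above ?P gs') * H' ?P \<le> 40000 * (real ?l + 1) * ?l"
    unfolding HP by (intro mult_right_mono) auto
  have pot: "potential B H (g # t) \<ge> (\<Sum>i<?p. charge (H i) (B - i)) + charge g (B - ?p)"
  proof -
    have "min (length (g # t)) ?P = Suc ?p" using False by simp
    then have "potential B H (g # t) = (\<Sum>i<?p. charge (H i) (B - i)) + charge (H ?p) (B - ?p)
        + real (extent_above ?P (g # t)) * H ?P"
      unfolding potential_def by (simp del: extent_above.simps)
    moreover have "0 \<le> real (extent_above ?P (g # t)) * H ?P" by simp
    ultimately show ?thesis using charge_mono[OF g, of "B - ?p"] by linarith
  qed
  have "g + (\<Sum>i=?p..<?P. charge ?l (B - i)) + 40000 * (real ?l + 1) * ?l \<le> charge g (B - ?p)"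
  proof (cases "g + ?p + 1 < B")
    case True
    then show ?thesis by (simp add: refill_bound_def charge_ge)
  next
    case F2: False
    have l: "?l = 2 * g div (B - ?p - 2) + 1" using False F2 by (simp add: refill_bound_def)
    have "real (2 * g div (B - ?p - 2)) \<le> real (2 * g) / real (B - ?p - 2)"
      by (rule of_nat_div_le_of_nat)
    moreover have "real (B - ?p - 2) = real (B - ?p) - 2" using p by linarith
    ultimately have "real (2 * g div (B - ?p - 2)) \<le> 2 * g / (real (B - ?p) - 2)"
      by (simp only: of_nat_mult of_nat_numeral)
    then have "real ?l \<le> 2 * g / (real (B - ?p) - 2) + 1"
      unfolding l of_nat_add of_nat_1 by (rule add_right_mono)
    then have c: "real g + real (B - ?p) * ?l + 20 * (?l * sqrt ?l) * sqrt (B - ?p) + 40000 * (real ?l)\<^sup>2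
        + 40000 * (real ?l + 1) * ?l \<le> charge g (B - ?p)"
      using False F2 by (intro charge_pays_for_refill) auto
    have "(\<Sum>i=?p..<?P. charge ?l (B - i))
      \<le> (real ?P - real ?p) * ?l + 20 * (?l * sqrt ?l) * (sqrt (real (B - ?p)) - sqrt (real (B - ?P)))
      + 40000 * (real ?l)\<^sup>2" using False p by (intro sum_charge_le) auto
    also have "\<dots> \<le> real (B - ?p) * ?l + 20 * (?l * sqrt ?l) * sqrt (real (B - ?p)) + 40000 * (real ?l)\<^sup>2"
      using False p by (intro add_mono mult_right_mono mult_left_mono) auto
    finally show ?thesis using c by (simp add: algebra_simps)
  qed
  then show ?thesis unfolding potential_def[of B H'] using a b pot by linarith
qed

text \<open>The budget of order \<open>sqrt N\<close> gives \<open>D \<le> 3 * sqrt N\<close> and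
  \<open>n * D \<le> 3 * N\<close>, which makes each part of the summed charges linear in
  \<open>N\<close>.\<close>

lemma potential_initial:
  assumes "length gs \<le> N" "1 \<le> N" "length gs + 2 \<le> B" "40001 * sqrt N \<le> B"
    "bounded_by (\<lambda>_. D) gs" "D = 2 * N div (B - 2) + 1"
  shows "potential B (\<lambda>_. D) gs \<le> 1000000 * N"
proof -
  define P where "P = B - 40000"
  define n where "n = min (length gs) P"
  have N: "1 \<le> sqrt N" "sqrt N * sqrt N = N" using assms(2) by auto
  have B: "40001 \<le> B" using assms(4) N by linarith
  have n: "n \<le> N" "n + 2 \<le> B" "n < B" using assms B unfolding n_def P_def by auto
  have d: "real D \<le> 2 * real N / (real B - 2) + 1"
    using of_nat_div_le_of_nat[of "2 * N" "B - 2"] B by (simp add: assms(6) of_nat_diff)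
  have b: "sqrt N \<le> real B - 2" using assms(4) N B by linarith
  have "2 * real N / (real B - 2) \<le> 2 * real N / sqrt N"
    using b N by (intro divide_left_mono mult_pos_pos) linarith+
  also have "\<dots> = 2 * sqrt N" by (metis real_div_sqrt times_divide_eq_right of_nat_0_le_iff)
  finally have D: "D \<le> 3 * sqrt N" using d N by linarith
  have "real D * D \<le> (3 * sqrt N) * (3 * sqrt N)" using D by (intro mult_mono) auto
  then have D2: "real D * D \<le> 9 * N" using N by simp
  have D1: "real D \<le> 3 * N"
  proof -
    have "3 * sqrt N * 1 \<le> 3 * sqrt N * sqrt N" using N by (intro mult_left_mono) auto
    then show ?thesis using D N by simp
  qed
  have nD: "real n * D \<le> 3 * real N"
  proof -
    have "real n * D \<le> real n * (2 * real N / (real B - 2) + 1)" using d by (intro mult_left_mono) auto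
    also have "\<dots> = (n / (real B - 2)) * (2 * real N) + n" by (simp add: algebra_simps)
    also have "\<dots> \<le> 1 * (2 * real N) + real N" using n B by (intro add_mono mult_right_mono) auto
    finally show ?thesis by simp
  qed
  have "D * sqrt D * sqrt n \<le> 6 * real N"
  proof -
    have "sqrt D * sqrt n = sqrt (real n * D)" by (simp add: real_sqrt_mult)
    also have "\<dots> \<le> sqrt (4 * N)" using nD by (intro real_sqrt_le_mono) auto
    also have "\<dots> = 2 * sqrt N" by (simp add: real_sqrt_mult)
    finally have q: "sqrt D * sqrt n \<le> 2 * sqrt N" .
    have "D * (sqrt D * sqrt n) \<le> (3 * sqrt N) * (2 * sqrt N)"
      by (rule mult_mono[OF D q]) simp_all
    then show ?thesis using N by (simp add: mult.assoc)
  qed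
  \<comment> \<open>Subadditivity of the root replaces the budget, which may far exceed
    \<open>N\<close>, by the number of gaps.\<close>
  moreover have "sqrt B - sqrt (B - n) \<le> sqrt n"
  proof -
    have "sqrt (real (B - n) + real n) \<le> sqrt (B - n) + sqrt n" by (rule sqrt_add_le_add_sqrt) auto
    moreover have "real (B - n) + real n = B" using n by simp
    ultimately show ?thesis by simp
  qed
  then have "D * sqrt D * (sqrt B - sqrt (B - n)) \<le> D * sqrt D * sqrt n"
    by (intro mult_left_mono) auto
  ultimately have c: "20 * (D * sqrt D) * (sqrt (real (B - 0)) - sqrt (real (B - n))) \<le> 120 * real N"
    by simp
  have "(\<Sum>i=0..<n. charge D (B - i))
    \<le> (real n - real 0) * D + 20 * (D * sqrt D) * (sqrt (real (B - 0)) - sqrt (real (B - n)))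
      + 40000 * (real D)\<^sup>2" using n by (intro sum_charge_le) auto
  also have "\<dots> \<le> 3 * real N + 120 * real N + 40000 * (9 * real N)"
    using nD D2 by (intro add_mono c) (auto simp: power2_eq_square)
  finally have s: "(\<Sum>i<n. charge D (B - i)) \<le> 3 * real N + 120 * real N + 40000 * (9 * real N)"
    by (simp add: lessThan_atLeast0)
  have "extent_above P gs \<le> (length gs - P) * Suc D"
    using extent_above_le[OF assms(5), of P] by (simp add: antimono_def)
  also have "\<dots> \<le> 40000 * Suc D" using assms(3) by (intro mult_right_mono) (auto simp: P_def)
  finally have "real (extent_above P gs) \<le> real (40000 * Suc D)" by linarith
  then have "real (extent_above P gs) * D \<le> real (40000 * Suc D) * D" by (intro mult_right_mono) auto
  also have "\<dots> = 40000 * (real D * D) + 40000 * D" by (simp add: algebra_simps)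
  finally show ?thesis unfolding potential_def using s D1 D2 unfolding n_def P_def by linarith
qed

section \<open>Runs of the machine on gap lists\<close>

text \<open>The semantics is relational with failure outcome \<open>None\<close>; \<open>ends_in\<close> is total correctness.\<close>

definition ends_in :: "('a option \<Rightarrow> bool) \<Rightarrow> ('a \<Rightarrow> bool) \<Rightarrow> bool" where
  "ends_in R Q \<longleftrightarrow> (\<exists>r. R r) \<and> (\<forall>r. R r \<longrightarrow> (\<exists>s. r = Some s \<and> Q s))"

section \<open>Total correctness rules for the operations of the machine\<close>

lemma ends_in_mono: "ends_in R P \<Longrightarrow> (\<And>s. P s \<Longrightarrow> Q s) \<Longrightarrow> ends_in R Q"
  unfolding ends_in_def by blast

lemma ends_in_ensure_Nil: "Q s \<Longrightarrow> ends_in (ensure N B L s []) Q"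
  unfolding ends_in_def by (auto intro: ensure_nil elim: ensure.cases)

text \<open>In an arbitrary state \<open>res\<close> and \<open>evi\<close> may overlap; excluding
  \<open>p\<close> from \<open>evi s\<close> leaves a single applicable rule.\<close>

lemma ends_in_ensure_res:
  assumes "p \<in> res s" "p \<notin> evi s" "ends_in (ensure N B (insert p L) s ps) Q"
  shows "ends_in (ensure N B L s (p # ps)) Q"
proof -
  have "ensure N B L s (p # ps) = ensure N B (insert p L) s ps"
    using assms(1,2) by (intro ext) (auto intro: ensure_res elim: ensure.cases)
  then show ?thesis using assms(3) unfolding ends_in_def by simp
qed

lemma ends_in_ensure_remat:
  assumes "p \<in> evi s" "p \<notin> res s" "ends_in (perform N B L s p) P"
    "\<And>s'. P s' \<Longrightarrow> ends_in (ensure N B (insert p L) s' ps) Q"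
  shows "ends_in (ensure N B L s (p # ps)) Q"
  unfolding ends_in_def
proof (intro conjI allI impI)
  obtain s' where "perform N B L s p (Some s')" "P s'" using assms(3) unfolding ends_in_def by blast
  moreover then obtain r where "ensure N B (insert p L) s' ps r"
    using assms(4) unfolding ends_in_def by blast
  ultimately show "\<exists>r. ensure N B L s (p # ps) r" using assms(1) ensure_remat by blast
next
  fix r assume "ensure N B L s (p # ps) r"
  then show "\<exists>s. r = Some s \<and> Q s"
  proof cases
    case (ensure_remat s')
    then show ?thesis using assms(3,4) unfolding ends_in_def by blast
  next
    case ensure_remat_fail
    then show ?thesis using assms(3) unfolding ends_in_def by blast
  qed (use assms(1,2) in auto)
qed

lemma ends_in_perform:
  assumes "ends_in (ensure N B L s (parents N x)) P"
    "\<And>s1. P s1 \<Longrightarrow> ends_in (alloc N B (L \<union> set (parents N x)) s1) (\<lambda>s2. Q (banish N (store s2 x)))"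
  shows "ends_in (perform N B L s x) Q"
  unfolding ends_in_def
proof (intro conjI allI impI)
  obtain s1 where "ensure N B L s (parents N x) (Some s1)" "P s1"
    using assms(1) unfolding ends_in_def by blast
  moreover then obtain s2 where "alloc N B (L \<union> set (parents N x)) s1 (Some s2)"
    using assms(2) unfolding ends_in_def by blast
  ultimately show "\<exists>r. perform N B L s x r" using perform_ok by blast
next
  fix r assume "perform N B L s x r"
  then show "\<exists>s. r = Some s \<and> Q s"
  proof cases
    case (perform_ok s1 s2)
    then show ?thesis using assms unfolding ends_in_def by blast
  next
    case perform_fail_inputs
    then show ?thesis using assms unfolding ends_in_def by blast
  next
    case (perform_fail_alloc s1)
    then show ?thesis using assms unfolding ends_in_def by blast
  qed
qed

lemma ends_in_run_Nil: "Q s \<Longrightarrow> ends_in (run N B [] s) Q"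
  unfolding ends_in_def by (auto intro: run_nil elim: run.cases)

lemma ends_in_run_Cons:
  assumes "ends_in (perform N B {} s x) P"
    "\<And>s'. P s' \<Longrightarrow> ends_in (run N B xs (banish N (s'\<lparr>ndone := Suc (ndone s')\<rparr>))) Q"
  shows "ends_in (run N B (x # xs) s) Q"
  unfolding ends_in_def
proof (intro conjI allI impI)
  obtain s1 where "perform N B {} s x (Some s1)" "P s1"
    using assms(1) unfolding ends_in_def by blast
  moreover then obtain r where "run N B xs (banish N (s1\<lparr>ndone := Suc (ndone s1)\<rparr>)) r"
    using assms(2) unfolding ends_in_def by blast
  ultimately show "\<exists>r. run N B (x # xs) s r" using run_step by blast
next
  fix r assume "run N B (x # xs) s r"
  then show "\<exists>s. r = Some s \<and> Q s"
  proof cases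
    case (run_step s')
    then show ?thesis using assms unfolding ends_in_def by blast
  next
    case run_fail
    then show ?thesis using assms unfolding ends_in_def by blast
  qed
qed

lemma ends_in_alloc_free: "card (res s) < B \<Longrightarrow> Q s \<Longrightarrow> ends_in (alloc N B L s) Q"
  unfolding ends_in_def by (auto intro: alloc_free elim: alloc.cases)

text \<open>An outcome exists because some evictable tensor minimises the score; \<open>Q\<close> is
  demanded for every minimiser, however ties are broken.\<close>

lemma ends_in_alloc_evict:
  assumes "B \<le> card (res s)" "evictable N s L u0"
    "\<And>u. evictable N s L u \<Longrightarrow> (\<And>u'. evictable N s L u' \<Longrightarrow> h_estar N s u \<le> h_estar N s u') \<Longrightarrow>
       ends_in (alloc N B L (evict s u)) Q"
  shows "ends_in (alloc N B L s) Q"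
  unfolding ends_in_def
proof (intro conjI allI impI)
  obtain u where u: "evictable N s L u" "\<And>u'. evictable N s L u' \<Longrightarrow> h_estar N s u \<le> h_estar N s u'"
    using ex_has_least_nat[of "evictable N s L" u0 "h_estar N s"] assms(2) by blast
  then obtain r where "alloc N B L (evict s u) r" using assms(3) unfolding ends_in_def by blast
  then show "\<exists>r. alloc N B L s r" using alloc_evict[of B s N L u r] assms(1) u by blast
next
  fix r assume "alloc N B L s r"
  then show "\<exists>s. r = Some s \<and> Q s"
  proof cases
    case (alloc_evict u)
    then show ?thesis using assms(3)[of u] unfolding ends_in_def by blast
  next
    case alloc_fail
    then show ?thesis using assms(2) by blast
  qed (use assms in auto)
qed

section \<open>Machine states as gap lists\<close>

text \<open>A trailing gap of \<open>g\<close> tensors follows \<open>t\<close>. A banished parent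
  makes each gradient in \<open>Gs\<close> unevictable, and all resident or evicted tensors are
  live, so banishing changes nothing.\<close>

definition gap_state :: "nat \<Rightarrow> dtr_state \<Rightarrow> nat \<Rightarrow> nat list \<Rightarrow> tensor set \<Rightarrow> bool" where
  "gap_state N s g t Gs \<longleftrightarrow>
     res s = F ` residents t \<union> Gs \<and> evi s = F ` ({1..g + extent t} - residents t) \<and>
     finite Gs \<and> Gs \<subseteq> range G \<and>
     (\<forall>x \<in> Gs. (\<exists>p \<in> set (parents N x). p \<in> ban s) \<and> live N s x) \<and>
     (\<forall>i \<in> {1..g + extent t}. F i \<notin> ban s \<and> live N s (F i))"

lemma live_cong: "ndone s = ndone s' \<Longrightarrow> live N s x = live N s' x"
  by (simp add: live_def)

lemma gap_state_res_F [simp]: "gap_state N s g t Gs \<Longrightarrow> F i \<in> res s \<longleftrightarrow> i \<in> residents t"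
  by (auto simp: gap_state_def)

lemma gap_state_evi_F [simp]:
  "gap_state N s g t Gs \<Longrightarrow> F i \<in> evi s \<longleftrightarrow> 1 \<le> i \<and> i \<le> g + extent t \<and> i \<notin> residents t"
  by (auto simp: gap_state_def)

lemma card_res:
  assumes "gap_state N s g t Gs"
  shows "card (res s) = length t + card Gs"
proof -
  have "card (F ` residents t \<union> Gs) = card (F ` residents t) + card Gs"
    using assms by (intro card_Un_disjoint) (auto simp: gap_state_def)
  then show ?thesis using assms by (simp add: gap_state_def card_image inj_on_def)
qed

lemma banish_all_live: "(\<And>x. x \<in> res s \<union> evi s \<Longrightarrow> live N s x) \<Longrightarrow> banish N s = s"
proof -
  assume "\<And>x. x \<in> res s \<union> evi s \<Longrightarrow> live N s x"
  then have "{t. banishable N s t} = {}" by (auto simp: banishable_def)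
  then show ?thesis by (simp add: banish_def)
qed

lemma gap_state_live:
  assumes "gap_state N s g t Gs" "x \<in> res s \<union> evi s"
  shows "live N s x"
  using assms residents_bounds[of _ t] by (fastforce simp: gap_state_def)

lemma gap_state_banish: "gap_state N s g t Gs \<Longrightarrow> banish N s = s"
  by (rule banish_all_live) (rule gap_state_live)

section \<open>Scores and evictable tensors in terms of gaps\<close>

lemma back_reach_iff:
  "back_reach N s (F i) u \<longleftrightarrow>
     (\<exists>j. u = F j \<and> 1 \<le> j \<and> j < i \<and> (\<forall>l. j \<le> l \<and> l < i \<longrightarrow> F l \<in> evi s))"
proof
  assume "back_reach N s (F i) u"
  then show "\<exists>j. u = F j \<and> 1 \<le> j \<and> j < i \<and> (\<forall>l. j \<le> l \<and> l < i \<longrightarrow> F l \<in> evi s)"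
  proof induction
    case (1 u)
    then have "2 \<le> i" "u = F (i - 1)" by (auto split: if_splits)
    moreover have "l = i - 1" if "i - 1 \<le> l \<and> l < i" for l using that by linarith
    ultimately show ?case using 1 by auto
  next
    case (2 v u)
    then obtain j where j: "v = F j" "1 \<le> j" "j < i" "\<forall>l. j \<le> l \<and> l < i \<longrightarrow> F l \<in> evi s" by blast
    then have "2 \<le> j" "u = F (j - 1)" using 2 by (auto split: if_splits)
    moreover have "l = j - 1 \<or> j \<le> l" if "j - 1 \<le> l" for l using that by linarith
    ultimately show ?case using j 2 by auto
  qed
next
  have "back_reach N s (F i) (F j)" if "1 \<le> j" "j + Suc d = i" "\<forall>l. j \<le> l \<and> l < i \<longrightarrow> F l \<in> evi s" for d j
    using that
  proof (induction d arbitrary: j)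
    case 0
    then show ?case by (intro back_reach.intros(1)) auto
  next
    case (Suc d)
    then have "back_reach N s (F i) (F (Suc j))" by auto
    then show ?case by (rule back_reach.intros(2)) (use Suc in auto)
  qed
  note chain = this
  assume "\<exists>j. u = F j \<and> 1 \<le> j \<and> j < i \<and> (\<forall>l. j \<le> l \<and> l < i \<longrightarrow> F l \<in> evi s)"
  then obtain j where j: "u = F j" "1 \<le> j" "j < i" "\<forall>l. j \<le> l \<and> l < i \<longrightarrow> F l \<in> evi s" by blast
  obtain d where "j + Suc d = i" using less_imp_Suc_add[OF j(3)] by auto
  then show "back_reach N s (F i) u" using chain j by blast
qed

text \<open>Gradients read forward tensors as well; the chain stays among forward tensors because
  \<open>evi s\<close> contains no gradient.\<close>

lemma fwd_reach_iff:
  assumes "evi s \<subseteq> range F" "1 \<le> i"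
  shows "fwd_reach N s (F i) u \<longleftrightarrow>
     (\<exists>j. u = F j \<and> i < j \<and> (\<forall>l. i < l \<and> l \<le> j \<longrightarrow> F l \<in> evi s))"
proof
  assume "fwd_reach N s (F i) u"
  then show "\<exists>j. u = F j \<and> i < j \<and> (\<forall>l. i < l \<and> l \<le> j \<longrightarrow> F l \<in> evi s)"
  proof induction
    case (1 u)
    then obtain j where j: "u = F j" using assms by blast
    then have "j = Suc i" using 1 by (auto split: if_splits)
    then show ?case using 1 j by (auto simp: le_Suc_eq)
  next
    case (2 v u)
    then obtain j where j: "v = F j" "i < j" "\<forall>l. i < l \<and> l \<le> j \<longrightarrow> F l \<in> evi s" by blast
    obtain k where k: "u = F k" using assms 2 by blast
    then have "k = Suc j" using 2 j by (auto split: if_splits)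
    then show ?case using j k 2 by (auto simp: le_Suc_eq)
  qed
next
  have "fwd_reach N s (F i) (F (i + Suc d))" if "\<forall>l. i < l \<and> l \<le> i + Suc d \<longrightarrow> F l \<in> evi s" for d
    using that
  proof (induction d)
    case 0
    then show ?case using assms by (intro fwd_reach.intros(1)) auto
  next
    case (Suc d)
    then have "fwd_reach N s (F i) (F (i + Suc d))" by auto
    then show ?case by (rule fwd_reach.intros(2)) (use Suc assms in auto)
  qed
  note chain = this
  assume "\<exists>j. u = F j \<and> i < j \<and> (\<forall>l. i < l \<and> l \<le> j \<longrightarrow> F l \<in> evi s)"
  then obtain j where j: "u = F j" "i < j" "\<forall>l. i < l \<and> l \<le> j \<longrightarrow> F l \<in> evi s" by blast
  obtain d where "j = i + Suc d" using less_imp_Suc_add[OF j(2)] by auto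
  then show "fwd_reach N s (F i) u" using chain j by blast
qed

text \<open>The evicted neighbourhood stops at the nearest resident on either side, which leaves the
  gap \<open>x\<close> below and the gap \<open>y\<close> above.\<close>

lemma h_estar_gap_state:
  assumes s: "gap_state N s g t Gs" and t: "t = ys @ y # x # zs"
  shows "h_estar N s (F (extent (x # zs))) = y + x"
proof -
  let ?a = "extent zs" and ?e = "extent (x # zs)" and ?b = "extent (y # x # zs)"
  have evi: "F l \<in> evi s" if "?a < l" "l < ?b" "l \<noteq> ?e" for l
  proof -
    have "l \<notin> residents t" using residents_between_gaps[of ys y x zs] that unfolding t
      by (metis IntI greaterThanLessThan_iff singletonD)
    moreover have "1 \<le> l" "l \<le> g + extent t" using that t by auto
    ultimately show ?thesis using gap_state_evi_F[OF s] by blast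
  qed
  \<comment> \<open>For \<open>zs = []\<close> the lower boundary is index 0, standing for the
    input, which is never evicted.\<close>
  have a: "F ?a \<notin> evi s"
  proof (cases "zs = []")
    case False
    then obtain z zs' where "zs = z # zs'" by (cases zs) auto
    then have "?a \<in> residents t" unfolding residents_iff t
      by (intro exI[of _ "ys @ [y, x]"] exI[of _ z] exI[of _ zs']) simp
    then show ?thesis using s by simp
  qed (use s in simp)
  have "?b \<in> residents t" unfolding residents_iff t by blast
  then have b: "F ?b \<notin> evi s" using s by simp
  have "estar N s (F ?e) = F ` ({?a<..<?e} \<union> {?e<..<?b})"
  proof -
    have "back_reach N s (F ?e) u \<longleftrightarrow> u \<in> F ` {?a<..<?e}" for u
    proof -
      have "(1 \<le> j \<and> j < ?e \<and> (\<forall>l. j \<le> l \<and> l < ?e \<longrightarrow> F l \<in> evi s)) \<longleftrightarrow> ?a < j \<and> j < ?e" for j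
      proof
        assume j: "1 \<le> j \<and> j < ?e \<and> (\<forall>l. j \<le> l \<and> l < ?e \<longrightarrow> F l \<in> evi s)"
        have "?a < j"
        proof (rule ccontr)
          assume "\<not> ?a < j"
          then have "F ?a \<in> evi s" using j by auto
          with a show False by blast
        qed
        then show "?a < j \<and> j < ?e" using j by blast
      qed (use evi in auto)
      then show ?thesis unfolding back_reach_iff by auto
    qed
    moreover have "fwd_reach N s (F ?e) u \<longleftrightarrow> u \<in> F ` {?e<..<?b}" for u
    proof -
      have "(?e < j \<and> (\<forall>l. ?e < l \<and> l \<le> j \<longrightarrow> F l \<in> evi s)) \<longleftrightarrow> ?e < j \<and> j < ?b" for j
      proof
        assume j: "?e < j \<and> (\<forall>l. ?e < l \<and> l \<le> j \<longrightarrow> F l \<in> evi s)"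
        have "j < ?b"
        proof (rule ccontr)
          assume "\<not> j < ?b"
          then have "F ?b \<in> evi s" using j by auto
          with b show False by blast
        qed
        then show "?e < j \<and> j < ?b" using j by blast
      qed (use evi in auto)
      moreover have "evi s \<subseteq> range F" using s by (auto simp: gap_state_def)
      ultimately show ?thesis by (subst fwd_reach_iff) auto
    qed
    ultimately show ?thesis unfolding estar_def by auto
  qed
  then have "h_estar N s (F ?e) = card ({?a<..<?e} \<union> {?e<..<?b})"
    unfolding h_estar_def by (simp only:) (rule card_image, simp add: inj_on_def)
  also have "\<dots> = card {?a<..<?e} + card {?e<..<?b}" by (rule card_Un_disjoint) auto
  finally show ?thesis by simp
qed

text \<open>Among forward tensors only the last resident is locked and none has a banished parent,
  while every gradient has one. Candidates are therefore the residents with an entry above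
  them.\<close>

lemma evictable_gap_state:
  assumes s: "gap_state N s g t Gs"
    and L: "L \<inter> range F = (if extent t = 0 then {} else {F (extent t)})"
  shows "evictable N s L u \<longleftrightarrow> (\<exists>ys y x zs. t = ys @ y # x # zs \<and> u = F (extent (x # zs)))"
proof
  assume u: "evictable N s L u"
  then have "u \<notin> Gs" using s by (auto simp: evictable_def gap_state_def)
  then obtain i where i: "u = F i" "i \<in> residents t" using u s by (auto simp: evictable_def gap_state_def)
  then obtain ys x zs where t: "t = ys @ x # zs" "i = extent (x # zs)" unfolding residents_iff by blast
  have "L \<inter> range F = {F (extent t)}" using L t by simp
  then have "F (extent t) \<in> L" by blast
  then have "ys \<noteq> []" using u i t by (auto simp: evictable_def)
  then obtain ys' y where "ys = ys' @ [y]" by (metis rev_exhaust)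
  then show "\<exists>ys y x zs. t = ys @ y # x # zs \<and> u = F (extent (x # zs))" using t i by auto
next
  assume "\<exists>ys y x zs. t = ys @ y # x # zs \<and> u = F (extent (x # zs))"
  then obtain ys y x zs where t: "t = ys @ y # x # zs" and u: "u = F (extent (x # zs))" by blast
  have "extent (x # zs) \<in> residents t" unfolding residents_iff t
    by (intro exI[of _ "ys @ [y]"] exI[of _ x] exI[of _ zs]) simp
  moreover have "u \<notin> L"
  proof
    assume "u \<in> L"
    moreover have "L \<inter> range F = {F (extent t)}" using L t by simp
    ultimately have "u = F (extent t)" using u by blast
    then show False using u t by simp
  qed
  moreover have "\<forall>p \<in> set (parents N u). p \<notin> ban s"
    using s u t by (auto simp: gap_state_def)
  ultimately show "evictable N s L u" using u s by (simp add: evictable_def)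
qed

lemma evict_gap_state:
  assumes s: "gap_state N s g (ys @ y # x # zs) Gs"
  shows "gap_state N (evict s (F (extent (x # zs)))) g (ys @ Suc (y + x) # zs) Gs"
proof -
  let ?t = "ys @ y # x # zs" and ?e = "extent (x # zs)"
  have e: "?e \<in> residents ?t" unfolding residents_iff
    by (intro exI[of _ "ys @ [y]"] exI[of _ x] exI[of _ zs]) simp
  then have m: "?e \<in> {1..g + extent ?t}" using residents_bounds by fastforce
  have "res (evict s (F ?e)) = F ` (residents ?t - {?e}) \<union> Gs"
    using s by (auto simp: gap_state_def evict_def)
  moreover have "evi (evict s (F ?e)) = F ` ({1..g + extent ?t} - (residents ?t - {?e}))"
  proof -
    have "evi (evict s (F ?e)) = insert (F ?e) (F ` ({1..g + extent ?t} - residents ?t))"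
      using s by (simp only: gap_state_def evict_def) simp
    also have "\<dots> = F ` ({1..g + extent ?t} - (residents ?t - {?e}))" using m by blast
    finally show ?thesis .
  qed
  moreover have "ban (evict s (F ?e)) = ban s" by (simp add: evict_def)
  moreover have "extent (ys @ Suc (y + x) # zs) = extent ?t" by simp
  moreover have "live N (evict s (F ?e)) = live N s" by (intro ext live_cong) (simp add: evict_def)
  ultimately show ?thesis
    using s unfolding gap_state_def residents_merge by (simp only: simp_thms) blast
qed

section \<open>Allocation and rematerialisation\<close>

text \<open>Each eviction is a minimal merge, so a property \<open>J\<close> stable under such
  merges in full memory survives. Two slots besides \<open>Gs\<close> guarantee an adjacent pair,
  hence allocation cannot fail.\<close>

lemma alloc_gap_state:
  assumes "gap_state N s g t Gs"
    and "L \<inter> range F = (if extent t = 0 then {} else {F (extent t)})"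
    and "J t" and J: "\<And>t t'. J t \<Longrightarrow> B \<le> length t + card Gs \<Longrightarrow> min_merge t t' \<Longrightarrow> J t'"
    and B: "card Gs + 2 \<le> B"
  shows "ends_in (alloc N B L s) (\<lambda>s'. \<exists>t'. gap_state N s' g t' Gs \<and> extent t' = extent t \<and> J t' \<and>
     length t' + card Gs < B \<and> ban s' = ban s \<and> nops s' = nops s \<and> ndone s' = ndone s)"
  using assms(1-3)
proof (induction "length t" arbitrary: t s rule: less_induct)
  case less
  note s = less.prems(1) and L = less.prems(2)
  show ?case
  proof (cases "length t + card Gs < B")
    case True
    then show ?thesis using less.prems card_res[OF s] by (intro ends_in_alloc_free) auto
  next
    case False
    note ev = evictable_gap_state[OF s L]
    obtain y0 x0 zs0 where "t = y0 # x0 # zs0" using False B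
      by (metis Suc_le_length_iff add_le_cancel_right add.commute linorder_not_less numeral_2_eq_2 order_trans)
    then have "evictable N s L (F (extent (x0 # zs0)))" unfolding ev by blast
    then show ?thesis
    proof (rule ends_in_alloc_evict[rotated])
      show "B \<le> card (res s)" using False card_res[OF s] by simp
      fix u assume u: "evictable N s L u"
        and min: "\<And>u'. evictable N s L u' \<Longrightarrow> h_estar N s u \<le> h_estar N s u'"
      obtain ys y x zs where t: "t = ys @ y # x # zs" and ue: "u = F (extent (x # zs))"
        using u unfolding ev by blast
      let ?t = "ys @ Suc (y + x) # zs"
      have "y + x \<le> y' + x'" if "t = ys' @ y' # x' # zs'" for ys' y' x' zs'
        using min[of "F (extent (x' # zs'))"] h_estar_gap_state[OF s t] h_estar_gap_state[OF s that] that
        unfolding ue ev by auto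
      then have "min_merge t ?t" unfolding min_merge_def using t by blast
      then have "J ?t" using J less.prems(3) False by auto
      moreover have "extent ?t = extent t" using t by simp
      moreover have "gap_state N (evict s u) g ?t Gs" using s evict_gap_state unfolding t ue by blast
      ultimately have "ends_in (alloc N B L (evict s u)) (\<lambda>s'. \<exists>t'. gap_state N s' g t' Gs \<and>
          extent t' = extent ?t \<and> J t' \<and> length t' + card Gs < B \<and> ban s' = ban (evict s u) \<and>
          nops s' = nops (evict s u) \<and> ndone s' = ndone (evict s u))"
        using L t by (intro less.hyps) auto
      then show "ends_in (alloc N B L (evict s u)) (\<lambda>s'. \<exists>t'. gap_state N s' g t' Gs \<and>
          extent t' = extent t \<and> J t' \<and> length t' + card Gs < B \<and> ban s' = ban s \<and>
          nops s' = nops s \<and> ndone s' = ndone s)"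
        using \<open>extent ?t = extent t\<close> by (simp add: evict_def)
    qed
  qed
qed

text \<open>Covers both uses: for \<open>g = 0\<close> the tensor is computed for the first time and
  truncated subtraction keeps the trailing gap empty; otherwise it is the lowest tensor of the
  trailing gap.\<close>

lemma store_gap_state:
  assumes s: "gap_state N s g t Gs" and F: "F (Suc (extent t)) \<notin> ban s" "live N s (F (Suc (extent t)))"
  shows "gap_state N (store s (F (Suc (extent t)))) (g - 1) (0 # t) Gs"
proof -
  let ?e = "Suc (extent t)"
  have "?e \<notin> residents t" using residents_bounds by fastforce
  have m: "{1..g - 1 + ?e} - insert ?e (residents t) = {1..g + extent t} - residents t - {?e}"
    by (cases g) auto
  have "F ` ({1..g + extent t} - residents t) - {F ?e} = F ` ({1..g + extent t} - residents t - {?e})"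
    by auto
  moreover have "live N (store s (F ?e)) = live N s" by (intro ext live_cong) (simp add: store_def)
  moreover have "F i \<notin> ban s \<and> live N s (F i)" if "i \<in> {1..g - 1 + ?e}" for i
    using that s F by (cases "i = ?e") (auto simp: gap_state_def)
  ultimately show ?thesis
    using s m unfolding gap_state_def store_def by simp
qed

text \<open>Induction on the distance \<open>d\<close> from the last resident mirrors the recursion.
  Each tensor on the way is locked while its successor is allocated, so it is computed only once.
  The first argument of \<open>J\<close> is the number of tensors still missing.\<close>

lemma perform_remat:
  assumes s: "gap_state N s g t Gs" and "J g t"
    and push: "\<And>g t. J (Suc g) t \<Longrightarrow> J g (0 # t)"
    and merge: "\<And>g t t'. J g t \<Longrightarrow> B \<le> length t + card Gs \<Longrightarrow> min_merge t t' \<Longrightarrow> J g t'"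
    and B: "card Gs + 2 \<le> B"
    and "1 \<le> d" "d \<le> g"
  shows "ends_in (perform N B {} s (F (extent t + d))) (\<lambda>s'. \<exists>t'. gap_state N s' (g - d) t' Gs \<and>
     extent t' = extent t + d \<and> J (g - d) t' \<and>
     ban s' = ban s \<and> ndone s' = ndone s \<and> nops s' = nops s + d)"
  using assms(6,7)
proof (induction d)
  case (Suc d)
  define P where "P d s' \<longleftrightarrow> (\<exists>t'. gap_state N s' (g - d) t' Gs \<and>
     extent t' = extent t + d \<and> J (g - d) t' \<and>
     ban s' = ban s \<and> ndone s' = ndone s \<and> nops s' = nops s + d)" for d s'
  let ?x = "F (extent t + Suc d)"
  have "ends_in (ensure N B {} s (parents N ?x)) (P d)"
  proof (cases "d = 0")
    case True
    have "P 0 s" unfolding P_def using s \<open>J g t\<close> by auto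
    then have *: "ends_in (ensure N B L s []) (P d)" for L using True by (intro ends_in_ensure_Nil) simp
    show ?thesis
    proof (cases "t = []")
      case True
      then show ?thesis using \<open>d = 0\<close> * by simp
    next
      case False
      then have "F (extent t) \<in> res s" "F (extent t) \<notin> evi s" using s by simp_all
      moreover have "1 \<le> extent t" using False residents_bounds extent_in_residents by blast
      ultimately show ?thesis using \<open>d = 0\<close> ends_in_ensure_res[OF _ _ *] by simp
    qed
  next
    case False
    have "extent t + d \<notin> residents t" using False residents_bounds by fastforce
    then have "F (extent t + d) \<in> evi s" "F (extent t + d) \<notin> res s" using s Suc.prems False by auto
    then have "ends_in (ensure N B {} s [F (extent t + d)]) (P d)"
    proof (rule ends_in_ensure_remat)
      show "ends_in (perform N B {} s (F (extent t + d))) (P d)"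
        using Suc False unfolding P_def by simp
    qed (rule ends_in_ensure_Nil)
    then show ?thesis using False by simp
  qed
  then have "ends_in (perform N B {} s ?x) (P (Suc d))"
  proof (rule ends_in_perform)
    fix s1 assume "P d s1"
    then obtain t1 where t1: "gap_state N s1 (g - d) t1 Gs" "extent t1 = extent t + d" "J (g - d) t1"
      "ban s1 = ban s" "ndone s1 = ndone s" "nops s1 = nops s + d" unfolding P_def by blast
    have "({} \<union> set (parents N ?x)) \<inter> range F = (if extent t1 = 0 then {} else {F (extent t1)})"
      using t1(2) by auto
    from alloc_gap_state[where J = "J (g - d)", OF t1(1) this t1(3) merge B]
    have "ends_in (alloc N B ({} \<union> set (parents N ?x)) s1) (\<lambda>s'. \<exists>t'. gap_state N s' (g - d) t' Gs \<and>
      extent t' = extent t1 \<and> J (g - d) t' \<and> length t' + card Gs < B \<and>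
      ban s' = ban s1 \<and> nops s' = nops s1 \<and> ndone s' = ndone s1)" .
    then show "ends_in (alloc N B ({} \<union> set (parents N ?x)) s1) (\<lambda>s2. P (Suc d) (banish N (store s2 ?x)))"
    proof (rule ends_in_mono)
      fix s2 assume "\<exists>t'. gap_state N s2 (g - d) t' Gs \<and> extent t' = extent t1 \<and> J (g - d) t' \<and>
        length t' + card Gs < B \<and> ban s2 = ban s1 \<and> nops s2 = nops s1 \<and> ndone s2 = ndone s1"
      then obtain t2 where t2: "gap_state N s2 (g - d) t2 Gs" "extent t2 = extent t1" "J (g - d) t2"
        "ban s2 = ban s1" "nops s2 = nops s1" "ndone s2 = ndone s1" by blast
      have e: "Suc (extent t2) = extent t + Suc d" using t1 t2 by simp
      have "Suc (extent t2) \<in> {1..g - d + extent t2}" using Suc.prems by auto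
      then have "F (Suc (extent t2)) \<notin> ban s2" "live N s2 (F (Suc (extent t2)))"
        using t2(1) unfolding gap_state_def by blast+
      from store_gap_state[OF t2(1) this]
      have st: "gap_state N (store s2 ?x) (g - Suc d) (0 # t2) Gs" unfolding e by simp
      have "g - d = Suc (g - Suc d)" using Suc.prems by simp
      then have "J (g - Suc d) (0 # t2)" using push[of "g - Suc d" t2] t2(3) by simp
      then show "P (Suc d) (banish N (store s2 ?x))"
        unfolding gap_state_banish[OF st] P_def using st t1 t2
        by (intro exI[of _ "0 # t2"]) (simp add: store_def)
    qed
  qed
  then show ?case unfolding P_def .
qed simp

section \<open>One step of the backward pass\<close>

definition grads :: "nat \<Rightarrow> nat \<Rightarrow> tensor set" where
  "grads N k = (if k = N then {} else {G (Suc k)})"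

text \<open>Situation just before \<open>G k\<close>. The trailing gap acts as the first entry of
  \<open>g # t\<close>, whose resident would be the banished tensor \<open>F k\<close>; thus
  \<open>extent (g # t) = k\<close>.\<close>

definition stage :: "nat \<Rightarrow> nat \<Rightarrow> nat \<Rightarrow> nat list \<Rightarrow> dtr_state \<Rightarrow> bool" where
  "stage N k g t s \<longleftrightarrow> gap_state N s g t (grads N k) \<and> Suc (g + extent t) = k \<and>
     ban s = F ` {k..N} \<union> G ` {k + 2..N} \<and> ndone s = N + (N - k)"

lemma card_grads: "card (grads N k) = (if k = N then 0 else 1)"
  by (simp add: grads_def)

lemma set_program: "set (program N) = F ` {1..N} \<union> G ` {1..N}"
  by (auto simp: program_def)

lemma set_drop_program:
  assumes "k \<le> N"
  shows "set (drop (N + (N - k)) (program N)) = G ` {1..k}"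
proof -
  have "drop (N + (N - k)) (program N) = map G (drop (N - k) (rev [1..<N + 1]))"
    by (simp add: program_def drop_map)
  also have "drop (N - k) (rev [1..<N + 1]) = rev [1..<k + 1]"
    using assms by (simp add: drop_rev take_upt del: upt_Suc)
  finally show ?thesis by auto
qed

lemma live_backward:
  assumes "ndone s = N + (N - k)" "k \<le> N"
  shows "live N s x \<longleftrightarrow> (\<exists>j \<in> {1..k}. x \<in> set (parents N (G j)))"
  unfolding live_def assms(1) set_drop_program[OF assms(2)] by auto

lemma live_forward:
  assumes "ndone s \<le> N" "1 \<le> i" "i < N"
  shows "live N s (F i)"
proof -
  have "drop N (program N) = map G (rev [1..<N + 1])" by (simp add: program_def)
  then have "G (Suc i) \<in> set (drop N (program N))" using assms by auto
  then have "G (Suc i) \<in> set (drop (ndone s) (program N))"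
    using set_drop_subset_set_drop[OF assms(1), of "program N"] by blast
  moreover have "F i \<in> set (parents N (G (Suc i)))" using assms by auto
  ultimately show ?thesis unfolding live_def by blast
qed

text \<open>The last gradient reads \<open>F (N - 1)\<close>, so \<open>F N\<close> is an input of
  no operation.\<close>

lemma last_forward_not_live: "\<not> live N s (F N)"
proof
  assume "live N s (F N)"
  then obtain x where "x \<in> set (program N)" "F N \<in> set (parents N x)"
    unfolding live_def using in_set_dropD by metis
  then show False by (auto simp: set_program split: if_splits)
qed

lemma children_last_forward: "children N (F N) = {}"
proof -
  have False if "valid N x" "F N \<in> set (parents N x)" for x
    using that by (cases x) (auto simp: valid_def split: if_splits)
  then show ?thesis by (auto simp: children_def)
qed

text \<open>Reading \<open>F (k - 1)\<close> forces the whole trailing gap to be recomputed at cost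
  \<open>g\<close>; for \<open>k < N\<close> the gradient \<open>G (Suc k)\<close> stays resident
  meanwhile, being unevictable.\<close>

lemma ends_in_stage_inputs:
  assumes st: "stage N k g t s" and k: "2 \<le> k" "k \<le> N" and B: "3 \<le> B" and "J g t"
    and push: "\<And>g t. J (Suc g) t \<Longrightarrow> J g (0 # t)"
    and merge: "\<And>g t t'. J g t \<Longrightarrow> B \<le> length t + card (grads N k) \<Longrightarrow> min_merge t t' \<Longrightarrow> J g t'"
  shows "ends_in (ensure N B {} s (parents N (G k))) (\<lambda>s'. \<exists>t'. gap_state N s' 0 t' (grads N k) \<and>
     extent t' = k - 1 \<and> J 0 t' \<and> ban s' = ban s \<and> ndone s' = ndone s \<and> nops s' = nops s + g)"
    (is "ends_in _ ?P")
proof -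
  have s: "gap_state N s g t (grads N k)" and m: "g + extent t = k - 1"
    using st by (auto simp: stage_def)
  have par: "parents N (G k) = F (k - 1) # (if k = N then [] else [G (Suc k)])" using k by auto
  have rest: "ends_in (ensure N B L s' (if k = N then [] else [G (Suc k)])) ?P" if P: "?P s'" for s' L
  proof (cases "k = N")
    case True
    then show ?thesis using P by (simp add: ends_in_ensure_Nil)
  next
    case False
    obtain t' where t': "gap_state N s' 0 t' (grads N k)" using P by blast
    have "G (Suc k) \<in> res s'" "G (Suc k) \<notin> evi s'"
      using t' False by (auto simp: gap_state_def grads_def)
    then show ?thesis using False P by (simp add: ends_in_ensure_res ends_in_ensure_Nil)
  qed
  show ?thesis
  proof (cases "g = 0")
    case True
    have e: "extent t = k - 1" "t \<noteq> []" using m True k by auto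
    then have "k - 1 \<in> residents t" by (metis extent_in_residents)
    then have "F (k - 1) \<in> res s" "F (k - 1) \<notin> evi s" using s by simp_all
    moreover have "?P s" using s e \<open>J g t\<close> True by auto
    ultimately show ?thesis unfolding par using rest by (intro ends_in_ensure_res)
  next
    case False
    have "k - 1 \<notin> residents t" using m False residents_bounds by fastforce
    then have e: "F (k - 1) \<in> evi s" "F (k - 1) \<notin> res s" using s k m by auto
    have "ends_in (perform N B {} s (F (extent t + g))) (\<lambda>s'. \<exists>t'. gap_state N s' (g - g) t' (grads N k) \<and>
       extent t' = extent t + g \<and> J (g - g) t' \<and>
       ban s' = ban s \<and> ndone s' = ndone s \<and> nops s' = nops s + g)"
      by (rule perform_remat[where J = J, OF s \<open>J g t\<close> push merge])
        (use B False in \<open>simp_all add: card_grads\<close>)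
    moreover have "extent t + g = k - 1" using m by simp
    ultimately have "ends_in (perform N B {} s (F (k - 1))) ?P" by simp
    then show ?thesis unfolding par using e rest by (intro ends_in_ensure_remat)
  qed
qed

text \<open>Completing \<open>G k\<close> leaves \<open>F (k - 1)\<close> and, for
  \<open>k < N\<close>, \<open>G (Suc k)\<close> without readers. Banishing \<open>F (k - 1)\<close>
  exposes the gap \<open>x\<close> below it as the new trailing gap.\<close>

lemma banish_after_gradient:
  assumes s: "gap_state N s 0 (x # t) (grads N k)" and e: "Suc (extent (x # t)) = k"
    and k: "2 \<le> k" "k \<le> N"
    and ban: "ban s = F ` {k..N} \<union> G ` {k + 2..N}" and nd: "ndone s = N + (N - k)"
  defines "s' \<equiv> banish N (store s (G k))"
  shows "stage N (k - 1) x t (banish N (s'\<lparr>ndone := Suc (ndone s')\<rparr>))" and "nops s' = Suc (nops s)"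
proof -
  have GkL: "G k \<in> set (parents N (G (k - 1)))" using k by (auto simp: numeral_2_eq_2 Suc_diff_Suc)
  have live_eq: "live N (store s (G k)) = live N s" by (intro ext live_cong) (simp add: store_def)
  have "live N s (G k)" unfolding live_backward[OF nd k(2)]
    using k by (intro bexI[of _ "k - 1"] GkL) auto
  \<comment> \<open>Inside \<open>perform\<close> the counter \<open>ndone\<close> has not advanced
    yet, so everything is still live and nothing is banished.\<close>
  have s': "s' = store s (G k)" unfolding s'_def
  proof (rule banish_all_live)
    fix y assume "y \<in> res (store s (G k)) \<union> evi (store s (G k))"
    then have "y = G k \<or> y \<in> res s \<union> evi s" by (auto simp: store_def)
    then show "live N (store s (G k)) y"
      unfolding live_eq using gap_state_live[OF s] \<open>live N s (G k)\<close> by blast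
  qed
  then show "nops s' = Suc (nops s)" by (simp add: store_def)
  define u where "u = s'\<lparr>ndone := Suc (ndone s')\<rparr>"
  have nd': "ndone u = N + (N - (k - 1))" using nd k by (simp add: u_def s' store_def)
  have res_u: "res u = insert (G k) (F ` residents (x # t) \<union> grads N k)"
    and evi_u: "evi u = F ` ({1..extent (x # t)} - residents (x # t))"
    and ban_u: "ban u = F ` {k..N} \<union> G ` {k + 2..N}"
    using s ban by (auto simp: u_def s' store_def gap_state_def)
  have live_u: "live N u y \<longleftrightarrow> (\<exists>j \<in> {1..k - 1}. y \<in> set (parents N (G j)))" for y
    using live_backward[OF nd'] k by simp
  have lF: "live N u (F i)" if "1 \<le> i" "i < k - 1" for i
    unfolding live_u using that k by (intro bexI[of _ "Suc i"]) auto
  have nlF: "\<not> live N u (F (k - 1))" unfolding live_u using k by (auto split: if_splits)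
  have lG: "live N u (G k)" unfolding live_u using k GkL by (intro bexI[of _ "k - 1"]) auto
  have nlG: "\<not> live N u (G (Suc k))" unfolding live_u using k by (auto split: if_splits)
  have chF: "c \<in> {F k, G k}" if "c \<in> children N (F (k - 1))" for c
    using that k by (cases c) (auto simp: children_def valid_def split: if_splits)
  have chG: "c = G k" if "c \<in> children N (G (Suc k))" for c
    using that k by (cases c) (auto simp: children_def valid_def split: if_splits)
  have r: "extent (x # t) = k - 1" using e by simp
  have r': "k - 1 \<in> residents (x # t)" using r by (metis extent_in_residents list.distinct(1))
  have X: "{y. banishable N u y} = insert (F (k - 1)) (grads N k)"
  proof (intro equalityI subsetI)
    fix y assume "y \<in> {y. banishable N u y}"
    then have y: "y \<in> res u \<union> evi u" "\<not> live N u y" by (auto simp: banishable_def)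
    then consider "y = G k" | "y \<in> grads N k" | i where "y = F i" "1 \<le> i" "i \<le> k - 1"
      unfolding res_u evi_u r using residents_bounds[of _ "x # t"] r by fastforce
    then show "y \<in> insert (F (k - 1)) (grads N k)"
    proof cases
      case 3
      then show ?thesis using lF[of i] y by (cases "i = k - 1") auto
    qed (use lG y in auto)
  next
    fix y assume "y \<in> insert (F (k - 1)) (grads N k)"
    then consider "y = F (k - 1)" | "y = G (Suc k)" "y \<in> grads N k" by (auto simp: grads_def split: if_splits)
    then show "y \<in> {y. banishable N u y}"
    proof cases
      case 1
      have "F k \<in> ban u" using k by (auto simp: ban_u)
      then show ?thesis using 1 nlF chF r' by (auto simp: banishable_def res_u)
    next
      case 2
      then show ?thesis using nlG chG by (auto simp: banishable_def res_u)
    qed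
  qed
  let ?v = "banish N u"
  have gr: "grads N (k - 1) = {G k}" using k by (auto simp: grads_def)
  have notin: "k - 1 \<notin> residents t" using residents_bounds[of "k - 1" t] r by auto
  have rt: "residents (x # t) = insert (k - 1) (residents t)" using r by simp
  have et: "x + extent t = k - 2" using r by simp
  have res_v: "res ?v = F ` residents t \<union> grads N (k - 1)"
  proof -
    have "res ?v = insert (G k) (F ` insert (k - 1) (residents t) \<union> grads N k) - insert (F (k - 1)) (grads N k)"
      unfolding banish_def Let_def X by (simp add: res_u[unfolded rt])
    moreover have "insert (G k) (F ` insert (k - 1) (residents t) \<union> grads N k) - insert (F (k - 1)) (grads N k)
        = F ` residents t \<union> {G k}"
      using notin by (cases "k = N") (auto simp: grads_def)
    ultimately show ?thesis unfolding gr by (simp only:)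
  qed
  have evi_v: "evi ?v = F ` ({1..x + extent t} - residents t)"
  proof -
    have "{1..k - 1} - insert (k - 1) (residents t) = {1..k - 2} - residents t" by auto
    moreover have "evi ?v = F ` ({1..k - 1} - insert (k - 1) (residents t))"
      unfolding banish_def Let_def X by (auto simp: evi_u[unfolded rt r] grads_def split: if_splits)
    ultimately show ?thesis by (simp add: et)
  qed
  have ban_v: "ban ?v = F ` {k - 1..N} \<union> G ` {k - 1 + 2..N}"
  proof -
    have "{k - 1..N} = insert (k - 1) {k..N}" using k by auto
    moreover have "G ` {k - 1 + 2..N} = G ` {k + 2..N} \<union> grads N k"
    proof (cases "k = N")
      case False
      then have "{k - 1 + 2..N} = insert (Suc k) {k + 2..N}" using k by auto
      then show ?thesis using False by (simp add: grads_def)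
    qed (auto simp: grads_def)
    moreover have "ban ?v = F ` {k..N} \<union> G ` {k + 2..N} \<union> insert (F (k - 1)) (grads N k)"
      unfolding banish_def Let_def X using ban_u by simp
    ultimately show ?thesis by auto
  qed
  have nd_v: "ndone ?v = ndone u" by (simp add: banish_def Let_def)
  have live_v: "live N ?v = live N u" by (intro ext live_cong nd_v)
  have "F (k - 1) \<in> set (parents N (G k))" using k by auto
  moreover have "F (k - 1) \<in> ban ?v" unfolding ban_v using k by auto
  ultimately have a: "\<forall>y \<in> grads N (k - 1). (\<exists>p \<in> set (parents N y). p \<in> ban ?v) \<and> live N ?v y"
    unfolding gr live_v using lG by blast
  have b: "\<forall>i \<in> {1..x + extent t}. F i \<notin> ban ?v \<and> live N ?v (F i)"
  proof
    fix i assume "i \<in> {1..x + extent t}"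
    then have "1 \<le> i" "i < k - 1" using et k by auto
    then show "F i \<notin> ban ?v \<and> live N ?v (F i)" unfolding ban_v live_v using lF by auto
  qed
  have fin: "finite (grads N (k - 1))" "grads N (k - 1) \<subseteq> range G" unfolding gr by auto
  have "gap_state N ?v x t (grads N (k - 1))"
    unfolding gap_state_def by (intro conjI res_v evi_v fin a b)
  then show "stage N (k - 1) x t (banish N (s'\<lparr>ndone := Suc (ndone s')\<rparr>))"
    unfolding u_def[symmetric] stage_def using ban_v nd_v nd' et k by auto
qed

text \<open>\<open>J\<close> and the rest of the run are parameters because the first two stages and
  the later ones use different invariants.\<close>

lemma ends_in_run_stage:
  assumes st: "stage N k g t s" and k: "2 \<le> k" "k \<le> N" and B: "3 \<le> B" and "J g t"
    and push: "\<And>g t. J (Suc g) t \<Longrightarrow> J g (0 # t)"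
    and merge: "\<And>g t t'. J g t \<Longrightarrow> B \<le> length t + card (grads N k) \<Longrightarrow> min_merge t t' \<Longrightarrow> J g t'"
    and continue: "\<And>s' x t'. stage N (k - 1) x t' s' \<Longrightarrow> J 0 (x # t') \<Longrightarrow>
      length (x # t') + card (grads N k) < B \<Longrightarrow> nops s' = nops s + g + 1 \<Longrightarrow>
      ends_in (run N B xs s') Q"
  shows "ends_in (run N B (G k # xs) s) Q"
proof -
  have ban: "ban s = F ` {k..N} \<union> G ` {k + 2..N}" and nd: "ndone s = N + (N - k)"
    using st by (auto simp: stage_def)
  define P where "P s' \<longleftrightarrow> (\<exists>s2 x t'. s' = banish N (store s2 (G k)) \<and>
    gap_state N s2 0 (x # t') (grads N k) \<and> extent (x # t') = k - 1 \<and> J 0 (x # t') \<and>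
    length (x # t') + card (grads N k) < B \<and> ban s2 = ban s \<and> ndone s2 = ndone s \<and>
    nops s2 = nops s + g)" for s'
  have "ends_in (perform N B {} s (G k)) P"
  proof (rule ends_in_perform)
    show "ends_in (ensure N B {} s (parents N (G k))) (\<lambda>s'. \<exists>t'. gap_state N s' 0 t' (grads N k) \<and>
      extent t' = k - 1 \<and> J 0 t' \<and> ban s' = ban s \<and> ndone s' = ndone s \<and> nops s' = nops s + g)"
      by (rule ends_in_stage_inputs[where J = J]) (fact assms)+
    fix s1 assume "\<exists>t'. gap_state N s1 0 t' (grads N k) \<and>
      extent t' = k - 1 \<and> J 0 t' \<and> ban s1 = ban s \<and> ndone s1 = ndone s \<and> nops s1 = nops s + g"
    then obtain t1 where t1: "gap_state N s1 0 t1 (grads N k)" "extent t1 = k - 1" "J 0 t1"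
      "ban s1 = ban s" "ndone s1 = ndone s" "nops s1 = nops s + g" by blast
    have L: "({} \<union> set (parents N (G k))) \<inter> range F = (if extent t1 = 0 then {} else {F (extent t1)})"
      using t1(2) k by auto
    have "card (grads N k) + 2 \<le> B" using B by (simp add: card_grads)
    from alloc_gap_state[where J = "J 0", OF t1(1) L t1(3) merge this]
    show "ends_in (alloc N B ({} \<union> set (parents N (G k))) s1) (\<lambda>s2. P (banish N (store s2 (G k))))"
    proof (rule ends_in_mono)
      fix s2 assume "\<exists>t'. gap_state N s2 0 t' (grads N k) \<and> extent t' = extent t1 \<and> J 0 t' \<and>
        length t' + card (grads N k) < B \<and> ban s2 = ban s1 \<and> nops s2 = nops s1 \<and> ndone s2 = ndone s1"
      then obtain t2 where t2: "gap_state N s2 0 t2 (grads N k)" "extent t2 = extent t1" "J 0 t2"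
        "length t2 + card (grads N k) < B" "ban s2 = ban s1" "nops s2 = nops s1" "ndone s2 = ndone s1"
        by blast
      obtain x t' where "t2 = x # t'" using t2(2) t1(2) k by (cases t2) auto
      then show "P (banish N (store s2 (G k)))" unfolding P_def using t1 t2
        by (intro exI[of _ s2] exI[of _ x] exI[of _ t']) simp
    qed
  qed
  then show ?thesis
  proof (rule ends_in_run_Cons)
    fix s' assume "P s'"
    then obtain s2 x t' where s': "s' = banish N (store s2 (G k))"
      and s2: "gap_state N s2 0 (x # t') (grads N k)" "extent (x # t') = k - 1" "J 0 (x # t')"
      "length (x # t') + card (grads N k) < B" "ban s2 = ban s" "ndone s2 = ndone s"
      "nops s2 = nops s + g" unfolding P_def by blast
    have e: "Suc (extent (x # t')) = k" using s2(2) k by simp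
    note * = banish_after_gradient[OF s2(1) e k s2(5)[unfolded ban] s2(6)[unfolded nd], folded s']
    show "ends_in (run N B xs (banish N (s'\<lparr>ndone := Suc (ndone s')\<rparr>))) Q"
      by (rule continue[OF *(1) s2(3,4)]) (simp add: banish_def Let_def *(2) s2(7))
  qed
qed

lemma ends_in_run_last:
  assumes st: "stage N 1 g t s" and N: "1 \<le> N" and B: "3 \<le> B"
  shows "ends_in (run N B [G 1] s) (\<lambda>s'. nops s' = Suc (nops s))"
proof -
  have t: "t = []" and s: "gap_state N s g t (grads N 1)" using st by (cases t; auto simp: stage_def)+
  have "ends_in (ensure N B {} s (parents N (G 1))) (\<lambda>s'. s' = s)"
  proof (cases "N = 1")
    case True
    then show ?thesis by (simp add: ends_in_ensure_Nil)
  next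
    case False
    have "G 2 \<in> res s" "G 2 \<notin> evi s" using s False by (auto simp: gap_state_def grads_def)
    then show ?thesis using False by (auto intro!: ends_in_ensure_res ends_in_ensure_Nil)
  qed
  then have "ends_in (perform N B {} s (G 1)) (\<lambda>s'. nops s' = Suc (nops s))"
  proof (rule ends_in_perform)
    fix s1 assume "s1 = s"
    moreover have "card (res s) < B" using card_res[OF s] t B by (simp add: card_grads)
    ultimately show "ends_in (alloc N B ({} \<union> set (parents N (G 1))) s1)
        (\<lambda>s2. nops (banish N (store s2 (G 1))) = Suc (nops s))"
      by (intro ends_in_alloc_free) (simp_all add: banish_def store_def Let_def)
  qed
  then show ?thesis
    by (rule ends_in_run_Cons) (auto intro!: ends_in_run_Nil simp: banish_def Let_def)
qed

section \<open>Amortised cost of the backward pass\<close>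

text \<open>The envelope is renewed at every stage, so the induction generalises over
  \<open>H\<close>. The potential pays for rematerialisations, the summand \<open>k\<close> for the
  gradients themselves.\<close>

lemma ends_in_run_backward:
  assumes "stage N k g t s" "1 \<le> k" "k < N" "length t + 3 \<le> B" "40000 < B"
    "bounded_by H (g # t)" "antimono H"
  shows "ends_in (run N B (map G (rev [1..<Suc k])) s)
    (\<lambda>s'. real (nops s') \<le> real (nops s) + potential B H (g # t) + real k)"
  using assms
proof (induction k arbitrary: g t s H rule: less_induct)
  case (less k)
  note st = less.prems(1) and H = less.prems(7) and len = less.prems(4) and B = less.prems(5)
  have pot: "0 \<le> potential B H (g # t)"
    unfolding potential_def by (intro add_nonneg_nonneg sum_nonneg) auto
  show ?case
  proof (cases "k = 1")
    case True
    have "ends_in (run N B [G 1] s) (\<lambda>s'. nops s' = Suc (nops s))"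
      using st less.prems True B by (intro ends_in_run_last) auto
    then show ?thesis using pot True by (auto elim!: ends_in_mono)
  next
    case False
    then have k: "2 \<le> k" "k \<le> N" using less.prems by auto
    let ?p = "length t" and ?P = "B - 40000"
    let ?l = "refill_bound B (length t) g"
    define H' where "H' = (\<lambda>i. if i < ?p then H i else ?l)"
    \<comment> \<open>The conjunct \<open>?p \<le> length t'\<close> ensures, when
      \<open>?P \<le> ?p\<close>, that every pushed entry is counted by \<open>extent_above\<close>,
      so pushing does not change the total.\<close>
    define J where "J g' t' \<longleftrightarrow> refill g ?p g' t' \<and> bounded_by H' t' \<and> ?p \<le> length t' \<and>
      (?P \<le> ?p \<longrightarrow> extent_above ?P (g' # t') \<le> extent_above ?P (g # t))" for g' t'
    have l: "?l \<le> g" using refill_bound_le len by blast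
    have g: "g \<le> H ?p" using less.prems(6) by simp
    have lH': "?l \<le> H' i" for i
      using l g antimonoD[OF H, of i ?p] by (auto simp: H'_def)
    have H': "antimono H'"
    proof (rule antimonoI)
      fix i j :: nat assume "i \<le> j"
      then show "H' j \<le> H' i" using lH'[of i] antimonoD[OF H, of i j] by (auto simp: H'_def)
    qed
    have "rev [1..<Suc k] = k # rev [1..<Suc (k - 1)]" using k by simp
    then have "map G (rev [1..<Suc k]) = G k # map G (rev [1..<Suc (k - 1)])" by simp
    moreover have "ends_in (run N B (G k # map G (rev [1..<Suc (k - 1)])) s)
      (\<lambda>s'. real (nops s') \<le> real (nops s) + potential B H (g # t) + real k)"
    proof (rule ends_in_run_stage[where J = J, OF st k])
      show "3 \<le> B" using B by simp
      have "bounded_by H' t"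
        using less.prems(6) by (auto simp: H'_def intro: bounded_by_mono[of H])
      then show "J g t" unfolding J_def using refill_start by simp
      show "J g' (0 # t')" if "J (Suc g') t'" for g' t'
        using that refill_push unfolding J_def by auto
      show "J g' t''" if J: "J g' t'" and full: "B \<le> length t' + card (grads N k)"
        and mm: "min_merge t' t''" for g' t' t''
      proof -
        have full': "B - 1 \<le> length t'" using full by (auto simp: card_grads split: if_splits)
        have "refill g ?p g' t'" using J by (simp add: J_def)
        from min_merge_refill[OF this mm full' len]
        obtain ys y x zs where t': "t' = ys @ y # x # zs" "t'' = ys @ Suc (y + x) # zs"
          "y + x \<le> 2 * g div (B - ?p - 2)" "Suc (y + x) \<le> g" "B \<le> g + ?p + 1" by blast
        \<comment> \<open>This holds wherever the merged pair lies; as \<open>?l\<close> is below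
          \<open>H'\<close> at every index, evictions below the trailing gap respect the envelope
          too.\<close>
        have "Suc (y + x) \<le> ?l" using t'(3-5) by (simp add: refill_bound_def)
        then have "Suc (y + x) \<le> H' (length zs)" using lH' order_trans by blast
        then have "bounded_by H' t''" using J H' bounded_by_merge unfolding J_def t' by blast
        moreover have "refill g ?p g' t''" using J refill_merge unfolding J_def t' by blast
        moreover have "extent_above ?P (g' # t'') \<le> extent_above ?P (g' # t')"
          using extent_above_merge[of ?P "g' # ys" y x zs] unfolding t' by simp
        moreover have "?p \<le> length t''" using full' len t' by simp
        ultimately show ?thesis using J order_trans unfolding J_def by blast
      qed
      fix s' x t' assume st': "stage N (k - 1) x t' s'" and J: "J 0 (x # t')"
        and len': "length (x # t') + card (grads N k) < B" and n: "nops s' = nops s + g + 1"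
      have len2: "length (x # t') + 2 \<le> B" using len' less.prems(3) by (simp add: card_grads)
      have b: "bounded_by H' (x # t')" using J unfolding J_def by blast
      have step: "real g + potential B H' (x # t') \<le> potential B H (g # t)"
      proof (rule potential_step[OF H len B g H'_def b len2 H'])
        assume P: "?P \<le> ?p"
        \<comment> \<open>The entry 0 is the emptied trailing gap; it still contributes one tensor,
          which is the decrease required.\<close>
        then have "extent_above ?P (0 # x # t') \<le> extent_above ?P (g # t)" "?P \<le> length (x # t')"
          using J unfolding J_def by auto
        then show "Suc (extent_above ?P (x # t')) \<le> extent_above ?P (g # t)"
          by (simp del: extent_above.simps add: extent_above.simps(2)[of _ 0])
      qed
      have "ends_in (run N B (map G (rev [1..<Suc (k - 1)])) s')
        (\<lambda>s''. real (nops s'') \<le> real (nops s') + potential B H' (x # t') + real (k - 1))"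
        using st' k less.prems(3) len2 B b H' by (intro less.IH) auto
      then show "ends_in (run N B (map G (rev [1..<Suc (k - 1)])) s')
        (\<lambda>s''. real (nops s'') \<le> real (nops s) + potential B H (g # t) + real k)"
      proof (rule ends_in_mono)
        fix s'' assume "real (nops s'') \<le> real (nops s') + potential B H' (x # t') + real (k - 1)"
        moreover have "real (k - 1) = real k - 1" using k by simp
        ultimately show "real (nops s'') \<le> real (nops s) + potential B H (g # t) + real k"
          using step n by simp
      qed
    qed
    ultimately show ?thesis by simp
  qed
qed

section \<open>The forward pass\<close>

lemma bounded_by_average_merge:
  assumes "min_merge t t'" "B - 1 \<le> length t" "extent t \<le> N" "3 \<le> B"
    "bounded_by (\<lambda>_. 2 * N div (B - 2) + 1) t"
  shows "bounded_by (\<lambda>_. 2 * N div (B - 2) + 1) t'"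
proof -
  have "min_merge (t @ []) t'" using assms(1) by simp
  then obtain ys y x zs where "t @ [] = ys @ y # x # zs" and t': "t' = ys @ Suc (y + x) # zs"
    and avg: "(y + x) * (length t - 1) \<le> 2 * sum_list t"
    by (rule min_merge_le_average)
  then have t: "t = ys @ y # x # zs" by simp
  have "(y + x) * (B - 2) \<le> (y + x) * (length t - 1)"
    using assms(2) by (intro mult_left_mono) auto
  also have "\<dots> \<le> 2 * N" using avg assms(3) by (simp add: extent_eq)
  finally have "y + x \<le> 2 * N div (B - 2)" using assms(4) by (simp add: less_eq_div_iff_mult_less_eq)
  then show ?thesis using assms(5) unfolding t t'
    by (intro bounded_by_merge) (auto simp: antimono_def)
qed

text \<open>The previous tensor is always the last resident, so nothing is rematerialised; averaging
  over the whole list keeps every gap within the constant envelope.\<close>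

lemma ends_in_run_forward:
  assumes "gap_state N s 0 t {}" "extent t < N" "ban s = {}" "ndone s = extent t" "nops s = extent t"
    "bounded_by (\<lambda>_. 2 * N div (B - 2) + 1) t" and B: "3 \<le> B"
    and continue: "\<And>s' t'. stage N N 0 t' s' \<Longrightarrow> length t' < B \<Longrightarrow>
      bounded_by (\<lambda>_. 2 * N div (B - 2) + 1) t' \<Longrightarrow> nops s' = N \<Longrightarrow> ends_in (run N B xs s') Q"
  shows "ends_in (run N B (map F [Suc (extent t)..<Suc N] @ xs) s) Q"
  using assms(1-6)
proof (induction "N - extent t" arbitrary: t s rule: less_induct)
  case less
  note s = less.prems(1)
  define n where "n = extent t"
  let ?D = "\<lambda>_. 2 * N div (B - 2) + 1" and ?x = "F (Suc n)"
  define J where "J t' \<longleftrightarrow> bounded_by ?D t' \<and> extent t' \<le> N" for t'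
  define P where "P s' \<longleftrightarrow> (\<exists>s2 t'. s' = banish N (store s2 ?x) \<and> gap_state N s2 0 t' {} \<and>
     extent t' = n \<and> J t' \<and> length t' < B \<and> ban s2 = {} \<and> nops s2 = n \<and> ndone s2 = n)" for s'
  have "ends_in (ensure N B {} s (parents N ?x)) (\<lambda>s'. s' = s)"
  proof (cases "n = 0")
    case True
    then show ?thesis by (simp add: ends_in_ensure_Nil)
  next
    case False
    then have "n \<in> residents t" unfolding n_def by (cases t) auto
    then have "F n \<in> res s" "F n \<notin> evi s" using s by simp_all
    then show ?thesis using False by (auto intro!: ends_in_ensure_res ends_in_ensure_Nil)
  qed
  then have perf: "ends_in (perform N B {} s ?x) P"
  proof (rule ends_in_perform)
    fix s1 assume "s1 = s"
    have L: "({} \<union> set (parents N ?x)) \<inter> range F = (if extent t = 0 then {} else {F (extent t)})"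
      by (auto simp: n_def)
    have "J t" unfolding J_def using less.prems by simp
    have merge: "J t''" if "J t'" "B \<le> length t' + card ({} :: tensor set)" "min_merge t' t''" for t' t''
      using that bounded_by_average_merge[of t' t'' B N] min_merge_extent[of t' t''] B
      unfolding J_def by auto
    have "card ({} :: tensor set) + 2 \<le> B" using B by simp
    from alloc_gap_state[where J = J, OF s L \<open>J t\<close> merge this]
    show "ends_in (alloc N B ({} \<union> set (parents N ?x)) s1) (\<lambda>s2. P (banish N (store s2 ?x)))"
      unfolding \<open>s1 = s\<close>
    proof (rule ends_in_mono)
      fix s2 assume "\<exists>t'. gap_state N s2 0 t' {} \<and> extent t' = extent t \<and> J t' \<and>
        length t' + card ({} :: tensor set) < B \<and> ban s2 = ban s \<and> nops s2 = nops s \<and> ndone s2 = ndone s"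
      then show "P (banish N (store s2 ?x))" unfolding P_def using less.prems n_def by auto
    qed
  qed
  have "map F [Suc (extent t)..<Suc N] = ?x # map F [Suc (Suc n)..<Suc N]"
    using less.prems(2) unfolding n_def by (simp add: upt_conv_Cons del: upt_Suc)
  moreover have "ends_in (run N B (?x # map F [Suc (Suc n)..<Suc N] @ xs) s) Q"
  proof (rule ends_in_run_Cons[OF perf])
    fix s' assume "P s'"
    then obtain s2 t' where s': "s' = banish N (store s2 ?x)" and s2: "gap_state N s2 0 t' {}"
      "extent t' = n" "J t'" "length t' < B" "ban s2 = {}" "nops s2 = n" "ndone s2 = n"
      unfolding P_def by blast
    have n: "n < N" using less.prems(2) by (simp add: n_def)
    let ?u = "s'\<lparr>ndone := Suc (ndone s')\<rparr>"
    show "ends_in (run N B (map F [Suc (Suc n)..<Suc N] @ xs) (banish N ?u)) Q"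
    proof (cases "Suc n < N")
      case True
      have "live N s2 (F (Suc n))" using True s2 by (intro live_forward) auto
      then have st: "gap_state N (store s2 ?x) 0 (0 # t') {}"
        using store_gap_state[OF s2(1)] s2 by simp
      then have s'': "s' = store s2 ?x" using gap_state_banish s' by simp
      have "live N ?u (F i)" if "1 \<le> i" "i \<le> Suc n" for i
        using that True s2 by (intro live_forward) (auto simp: s'' store_def)
      then have u: "gap_state N ?u 0 (0 # t') {}"
        using st s2 unfolding gap_state_def s'' by (auto simp: store_def)
      have "ends_in (run N B (map F [Suc (extent (0 # t'))..<Suc N] @ xs) ?u) Q"
        using n True s2 u
        by (intro less.hyps) (auto simp: n_def[symmetric] s'' store_def J_def)
      then show ?thesis using gap_state_banish[OF u] s2(2) by simp
    next
      case False
      then have nN: "Suc n = N" using n by simp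
      let ?v = "store s2 ?x"
      have lv: "live N ?v (F i)" if "1 \<le> i" "i < N" for i
        using that n s2 by (intro live_forward) (auto simp: store_def)
      have res_v: "res ?v = insert (F N) (F ` residents t')"
        and evi_v: "evi ?v = F ` ({1..n} - residents t')"
        using s2 nN by (auto simp: gap_state_def store_def)
      have rt: "1 \<le> i \<and> i < N" if "i \<in> residents t'" for i
        using residents_bounds[OF that] s2(2) n by simp
      \<comment> \<open>Without readers and children, \<open>F N\<close> is banished as soon as it
        is stored.\<close>
      have X: "{y. banishable N ?v y} = {F N}"
      proof (intro equalityI subsetI)
        fix y assume "y \<in> {y. banishable N ?v y}"
        then have y: "y \<in> res ?v \<union> evi ?v" "\<not> live N ?v y" by (auto simp: banishable_def)
        then obtain i where i: "y = F i" "1 \<le> i" "i \<le> N"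
          unfolding res_v evi_v using rt n by fastforce
        then show "y \<in> {F N}" using lv[of i] y(2) by (cases "i = N") auto
      next
        fix y assume "y \<in> {F N}"
        then show "y \<in> {y. banishable N ?v y}"
          using last_forward_not_live children_last_forward by (simp add: banishable_def res_v)
      qed
      have s'': "s' = ?v\<lparr>res := F ` residents t', evi := F ` ({1..n} - residents t'), ban := {F N}\<rparr>"
      proof -
        have "res ?v - {F N} = F ` residents t'" using rt by (auto simp: res_v)
        moreover have "evi ?v - {F N} = F ` ({1..n} - residents t')" using nN by (auto simp: evi_v)
        moreover have "ban ?v = {}" using s2 by (simp add: store_def)
        ultimately show ?thesis unfolding s' banish_def Let_def X by simp
      qed
      have lu: "live N ?u (F i)" if "1 \<le> i" "i < N" for i
        using that nN s2 by (intro live_forward) (auto simp: s'' store_def)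
      have u: "gap_state N ?u 0 t' {}"
        unfolding gap_state_def using s2 lu nN by (auto simp: s'')
      then have "stage N N 0 t' ?u"
        unfolding stage_def using s2 nN by (auto simp: s'' grads_def store_def)
      moreover have "nops ?u = N" using s2 nN by (simp add: s'' store_def)
      ultimately have "ends_in (run N B xs ?u) Q" using s2 continue unfolding J_def by blast
      then show ?thesis using gap_state_banish[OF u] nN by simp
    qed
  qed
  ultimately show ?case by simp
qed

section \<open>The whole program\<close>

text \<open>Stages \<open>N\<close> and \<open>N - 1\<close> run under the constant envelope and
  cost at most \<open>N + 2\<close>. Only after a stage with a gradient in memory is
  \<open>length t + 3 \<le> B\<close> known, as the amortised bound requires.\<close>

lemma ends_in_program:
  assumes N: "1 \<le> N" and B: "50000 * sqrt N \<le> B"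
  shows "ends_in (run N B (program N) init_state) (\<lambda>s. nops s \<le> 2000000 * N)"
proof -
  define D where "D = 2 * N div (B - 2) + 1"
  define J where "J g t \<longleftrightarrow> bounded_by (\<lambda>_. D) t \<and> g + extent t \<le> N" for g t
  have "1 \<le> sqrt N" using N by simp
  \<comment> \<open>As \<open>N \<ge> 1\<close>, the factor 50000 puts \<open>B\<close> above the
    threshold 40000 of the potential.\<close>
  then have B': "50000 \<le> B" "40001 * sqrt N \<le> B" using B by linarith+
  have D: "D \<le> 2 * N + 1" unfolding D_def using div_le_dividend by simp
  have push: "J g (0 # t)" if "J (Suc g) t" for g t using that by (simp add: J_def)
  have merge: "J g t'" if "J g t" "B \<le> length t + card (grads N k)" "min_merge t t'" for g t t' k
    using that bounded_by_average_merge[of t t' B N] min_merge_extent[of t t'] B'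
    unfolding J_def D_def by (auto simp: card_grads split: if_splits)
  have prog: "program N = map F [Suc (extent [])..<Suc N] @ map G (rev [1..<Suc N])"
    by (simp add: program_def)
  have dec: "map G (rev [1..<Suc k]) = G k # map G (rev [1..<Suc (k - 1)])" if "1 \<le> k" for k
    using that by (cases k) auto
  show ?thesis unfolding prog
  proof (rule ends_in_run_forward)
    show "gap_state N init_state 0 [] {}" by (simp add: gap_state_def init_state_def)
    fix s t assume st: "stage N N 0 t s" and len: "length t < B"
      and bd: "bounded_by (\<lambda>_. 2 * N div (B - 2) + 1) t" and n: "nops s = N"
    show "ends_in (run N B (map G (rev [1..<Suc N])) s) (\<lambda>s. nops s \<le> 2000000 * N)"
    proof (cases "N = 1")
      case True
      have "ends_in (run N B [G 1] s) (\<lambda>s'. nops s' = Suc (nops s))"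
        using st True B' by (intro ends_in_run_last) auto
      then show ?thesis using True n by (auto elim!: ends_in_mono)
    next
      case False
      then have N2: "2 \<le> N" using N by simp
      show ?thesis unfolding dec[OF N]
      proof (rule ends_in_run_stage[where J = J, OF st N2 order_refl _ _ push merge])
        show "3 \<le> B" using B' by simp
        show "J 0 t" using bd st unfolding J_def D_def stage_def by auto
        fix s1 g1 t1 assume st1: "stage N (N - 1) g1 t1 s1" and J1: "J 0 (g1 # t1)"
          and len1: "length (g1 # t1) + card (grads N N) < B" and n1: "nops s1 = nops s + 0 + 1"
        show "ends_in (run N B (map G (rev [1..<Suc (N - 1)])) s1) (\<lambda>s. nops s \<le> 2000000 * N)"
        proof (cases "N = 2")
          case True
          have "ends_in (run N B [G 1] s1) (\<lambda>s'. nops s' = Suc (nops s1))"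
            using st1 True B' by (intro ends_in_run_last) auto
          then show ?thesis using True n n1 by (auto elim!: ends_in_mono)
        next
          case False
          then have k: "2 \<le> N - 1" "N - 1 \<le> N" "1 \<le> N - 1" using N2 by auto
          show ?thesis unfolding dec[OF k(3)]
          proof (rule ends_in_run_stage[where J = J, OF st1 k(1,2) _ _ push merge])
            show "3 \<le> B" using B' by simp
            show "J g1 t1" using J1 by (simp add: J_def)
            fix s2 g2 t2 assume st2: "stage N (N - 1 - 1) g2 t2 s2" and J2: "J 0 (g2 # t2)"
              and len2: "length (g2 # t2) + card (grads N (N - 1)) < B"
              and n2: "nops s2 = nops s1 + g1 + 1"
            have "N - 1 \<noteq> N" using k by linarith
            then have len3: "length (g2 # t2) + 2 \<le> B" using len2 by (simp add: card_grads)
            have "ends_in (run N B (map G (rev [1..<Suc (N - 1 - 1)])) s2)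
              (\<lambda>s'. real (nops s') \<le> real (nops s2) + potential B (\<lambda>_. D) (g2 # t2) + real (N - 1 - 1))"
              using st2 k len3 B' J2 by (intro ends_in_run_backward) (auto simp: J_def antimono_def)
            then show "ends_in (run N B (map G (rev [1..<Suc (N - 1 - 1)])) s2)
              (\<lambda>s. nops s \<le> 2000000 * N)"
            proof (rule ends_in_mono)
              fix s' assume s': "real (nops s') \<le> real (nops s2) + potential B (\<lambda>_. D) (g2 # t2) + real (N - 1 - 1)"
              have "length (g2 # t2) \<le> N" using J2 length_le_extent[of "g2 # t2"] by (simp add: J_def)
              then have "potential B (\<lambda>_. D) (g2 # t2) \<le> 1000000 * N"
                using J2 N len3 B' unfolding D_def J_def by (intro potential_initial) auto
              moreover have "g1 \<le> N" using J1 by (simp add: J_def)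
              \<comment> \<open>The total consists of \<open>N\<close> forward operations, at most
                \<open>N + 2\<close> for two stages, \<open>1000000 * N\<close> from the potential
                and \<open>N - 2\<close> gradients.\<close>
              ultimately have "real (nops s') \<le> real (2000000 * N)"
                using s' n n1 n2 N2 by simp
              then show "nops s' \<le> 2000000 * N" by linarith
            qed
          qed
        qed
      qed
    qed
  qed (use N B' in \<open>auto simp: init_state_def\<close>)
qed

theorem theorem1:
  "\<exists>c > (0::real). \<exists>C::nat. \<forall>N \<ge> 1. \<forall>B::nat. real B \<ge> c * sqrt (real N) \<longrightarrow>
     (\<exists>r. dtr_run N B r) \<and>
     (\<forall>r. dtr_run N B r \<longrightarrow> (\<exists>s. r = Some s \<and> nops s \<le> C * N))"
proof (rule exI[of _ 50000], intro conjI, simp, rule exI[of _ 2000000], intro allI impI)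
  fix N B :: nat
  assume "1 \<le> N" "50000 * sqrt (real N) \<le> real B"
  then show "(\<exists>r. dtr_run N B r) \<and>
     (\<forall>r. dtr_run N B r \<longrightarrow> (\<exists>s. r = Some s \<and> nops s \<le> 2000000 * N))"
    using ends_in_program[of N B] unfolding ends_in_def dtr_run_def by blast
qed

end
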